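(* Let $h$ be a fixed positive integer and let $k,l,m\ge 2$ be integers. As $x\to\infty$, $$\sum_{u,v,w\le x}\frac{g(u,v,w)}{[u,v,w]}\,d_{k-1}(u)\,d_{l-1}(v)\,d_{m-1}(w)=\nabla_{h,k,l,m}\,\frac{(\log x)^{k+l+m-3}}{(k-1)!\,(l-1)!\,(m-1)!}+O\!\left((\log x)^{k+l+m-4}\right),$$ where the sum is over positive integers $u,v,w\le x$.
   Context: For integers $k\ge1$ and $n\ge1$, $d_k(n)$ denotes the number of $k$-tuples $(x_1,\dots,x_k)\in\mathbb{N}^k$ of positive integers with $x_1\cdots x_k=n$ (so $d_1\equiv 1$). For positive integers $u,v,w$, $[u,v,w]$ denotes their least common multiple, and $g(u,v,w)=1$ if the system of congruences $n\equiv -h \pmod u$, $n\equiv 0\pmod v$, $n\equiv h\pmod w$ has an integer solution $n$, and $g(u,v,w)=0$ otherwise. The constant $\nabla_{h,k,l,m}$ is $$\nabla_{h,k,l,m}=\prod_{p\mid 2h}\left[\left(1-\frac1p\right)^{k+l+m-3}\sum_{\nu_1,\nu_2,\nu_3\ge 0} d_{k-1}(p^{\nu_1})d_{l-1}(p^{\nu_2})d_{m-1}(p^{\nu_3})\frac{g(p^{\nu_1},p^{\nu_2},p^{\nu_3})}{[p^{\nu_1},p^{\nu_2},p^{\nu_3}]}\right]\times\prod_{p\nmid 2h}\left[\left(1-\frac1p\right)^{k+l+m-3}\left\{\left(1-\frac1p\right)^{1-k}+\left(1-\frac1p\right)^{1-l}+\left(1-\frac1p\right)^{1-m}-2\right\}\right],$$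 where $p$ runs over primes. *)

theory Defs
  imports
    "HOL-Analysis.Analysis"
    "HOL-Library.Landau_Symbols"
    "HOL-Number_Theory.Cong"
    "HOL-Computational_Algebra.Primes"
begin

text \<open>Tuples of length \<open>k\<close> are represented as lists of length \<open>k\<close>.\<close>

definition divisor_fun :: "nat \<Rightarrow> nat \<Rightarrow> nat" where
  "divisor_fun k n =
     card {xs :: nat list. length xs = k \<and> (\<forall>x\<in>set xs. x > 0) \<and> prod_list xs = n}"

definition g :: "nat \<Rightarrow> nat \<Rightarrow> nat \<Rightarrow> nat \<Rightarrow> real" where
  "g h u v w =
     (if \<exists>n::int. [n = - int h] (mod int u) \<and> [n = 0] (mod int v) \<and> [n = int h] (mod int w)
      then 1 else 0)"

abbreviation lcm3 :: "nat \<Rightarrow> nat \<Rightarrow> nat \<Rightarrow> nat" where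
  "lcm3 u v w \<equiv> lcm u (lcm v w)"

definition local_factor_dvd :: "nat \<Rightarrow> nat \<Rightarrow> nat \<Rightarrow> nat \<Rightarrow> nat \<Rightarrow> real" where
  "local_factor_dvd h k l m p =
     (1 - 1 / real p) ^ (k + l + m - 3) *
     (\<Sum>\<^sub>\<infinity>(a, b, c)\<in>(UNIV :: (nat \<times> nat \<times> nat) set).
        real (divisor_fun (k - 1) (p ^ a)) * real (divisor_fun (l - 1) (p ^ b)) *
        real (divisor_fun (m - 1) (p ^ c)) *
        (g h (p ^ a) (p ^ b) (p ^ c) / real (lcm3 (p ^ a) (p ^ b) (p ^ c))))"

definition local_factor_ndvd :: "nat \<Rightarrow> nat \<Rightarrow> nat \<Rightarrow> nat \<Rightarrow> real" where
  "local_factor_ndvd k l m p =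
     (1 - 1 / real p) ^ (k + l + m - 3) *
     ((1 - 1 / real p) powi (1 - int k) + (1 - 1 / real p) powi (1 - int l) +
      (1 - 1 / real p) powi (1 - int m) - 2)"

text \<open>
  The infinite product over the primes not dividing \<open>2 * h\<close> is a product over all natural
  numbers in which every other index contributes the factor \<open>1\<close>.
\<close>

definition nabla :: "nat \<Rightarrow> nat \<Rightarrow> nat \<Rightarrow> nat \<Rightarrow> real" where
  "nabla h k l m =
     (\<Prod>p | prime p \<and> p dvd 2 * h. local_factor_dvd h k l m p) *
     (\<Prod>p. if prime p \<and> \<not> p dvd 2 * h then local_factor_ndvd k l m p else 1)"

end

theory Submission
  imports Defs "HOL-Computational_Algebra.Formal_Power_Series" "HOL-Computational_Algebra.Squarefree"
begin

text \<open>
  The congruences are solvable iff \<open>gcd u v\<close> and \<open>gcd v w\<close> divide \<open>h\<close> and \<open>gcd u w\<close> divides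
  \<open>2 * h\<close>, so the summand is a multiplicative function of \<open>(u, v, w)\<close>, bounded by a constant times
  \<open>d u / u * d v / v * d w / w\<close> and equal to this product when only one of \<open>u, v, w\<close> differs
  from \<open>1\<close>. Hence it is the three-variable Dirichlet convolution of that product with a multiplicative
  function \<open>b\<close> whose values at \<open>(p, 1, 1)\<close>, \<open>(1, p, 1)\<close> and \<open>(1, 1, p)\<close> vanish. Therefore
  \<open>\<Sum>\<bar>b u v w\<bar> * (u * v * w) powr (1/4)\<close> converges, \<open>\<Sum>b u v w\<close> has an Euler product, which is
  \<open>nabla\<close>, and the sum in question is \<open>\<Sum>b a b' c * D (x / a) * D (x / b') * D (x / c)\<close>, where the
  sums \<open>D\<close> of \<open>d n / n\<close> satisfy \<open>D (x / a) = ln x ^ k / fact k + O(ln x ^ (k - 1) * (1 + ln a))\<close>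
  uniformly in \<open>a\<close>.
\<close>

section \<open>Power series in three variables\<close>

text \<open>What decides the method is uniformity in p: at every prime, those dividing 2 h included,
  the quotient of the two Euler factors must differ from 1 by a summable amount, with one constant
  for all primes. In the ring of nested formal series, this quotient arises by multiplying with an
  explicit polynomial, and a submultiplicative weighted l1 norm bounds it without any coefficient
  being computed. As the coefficients of size 1 vanish, a norm bound at a radius proportional to p
  gives O(p^(-2(1 - s))) for the nonconstant part at radius p^s. The exponent s = 1/4 is one choice
  with s > 0, which absorbs logarithms, and 2(1 - s) > 1, which makes the sum over primes converge.
  Because the estimate for D (x / a) persists where D (x / a) = 0, the finite sum can be regarded as
  a sum over all triples and compared with the main term one triple at a time; no tail is ever
  estimated. Errors are measured in powers of 1 + ln x, which are at least 1 for all x >= 1 and so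
  can be used at every x / n with n \<le> x.\<close>

definition coeff3 :: "real fps fps fps \<Rightarrow> nat \<times> nat \<times> nat \<Rightarrow> real" where
  "coeff3 F = (\<lambda>(a, b, c). fps_nth (fps_nth (fps_nth F a) b) c)"

definition size3 :: "nat \<times> nat \<times> nat \<Rightarrow> nat" where
  "size3 = (\<lambda>(a, b, c). a + b + c)"

lemma size3_add [simp]: "size3 (d + e) = size3 d + size3 e"
  by (auto simp: size3_def split: prod.splits)

lemma size3_simps [simp]: "size3 (a, b, c) = a + b + c" "size3 0 = 0"
  by (auto simp: size3_def zero_prod_def)

lemma atMost_triple: "{..(a::nat, b::nat, c::nat)} = {..a} \<times> {..b} \<times> {..c}"
  by auto

lemma finite_atMost_triple [simp]: "finite {..e :: nat \<times> nat \<times> nat}"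
  by (cases e) (simp add: atMost_triple)

lemma triple_add_diff: "d \<le> e \<Longrightarrow> d + (e - d) = (e :: nat \<times> nat \<times> nat)"
  by (cases d; cases e) auto

lemma triple_add_diff' [simp]: "d + e - d = (e :: nat \<times> nat \<times> nat)"
  by (cases d; cases e) auto

lemma triple_le_add [simp]: "d \<le> d + (e :: nat \<times> nat \<times> nat)"
  by (cases d; cases e) auto

lemma size3_mono: "d \<le> e \<Longrightarrow> size3 d \<le> size3 e"
  by (cases d; cases e) auto

text \<open>The order on triples is componentwise, so the index set is a box on which
  \<open>e - d\<close> is a true difference, and three nested Cauchy products become one sum over
  triples.\<close>

lemma coeff3_mult: "coeff3 (F * G) e = (\<Sum>d\<in>{..e}. coeff3 F d * coeff3 G (e - d))"
proof (cases e)
  case (fields a b c)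
  have "coeff3 (F * G) e = (\<Sum>i\<le>a. \<Sum>j\<le>b. \<Sum>l\<le>c. coeff3 F (i, j, l) * coeff3 G (e - (i, j, l)))"
    by (simp add: fields coeff3_def fps_mult_nth fps_sum_nth atLeast0AtMost)
  thus ?thesis
    by (simp add: fields atMost_triple sum.Sigma case_prod_unfold minus_prod_def)
qed

lemma coeff3_add: "coeff3 (F + G) e = coeff3 F e + coeff3 G e"
  by (cases e) (auto simp: coeff3_def)

lemma coeff3_diff: "coeff3 (F - G) e = coeff3 F e - coeff3 G e"
  by (cases e) (auto simp: coeff3_def)

lemma coeff3_1: "coeff3 1 e = (if e = 0 then 1 else 0)"
  by (cases e) (auto simp: coeff3_def zero_prod_def)

lemma coeff3_eqI: "(\<And>e. coeff3 F e = coeff3 G e) \<Longrightarrow> F = G"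
  unfolding coeff3_def by (intro fps_ext) (metis (mono_tags, lifting) case_prod_conv)

text \<open>Over the reals, summable and absolutely summable families coincide; this is what turns
  the iterated sum into a sum over pairs.\<close>

lemma has_sum_times:
  fixes f :: "'a \<Rightarrow> real" and f' :: "'b \<Rightarrow> real"
  assumes "(f has_sum S) A" "(f' has_sum T) B"
  shows "((\<lambda>(d, e). f d * f' e) has_sum (S * T)) (A \<times> B)"
proof (rule has_sum_SigmaI)
  show "((\<lambda>e. case (d, e) of (d, e) \<Rightarrow> f d * f' e) has_sum (f d * T)) B" for d
    using assms(2) by (simp add: has_sum_cmult_right)
  show "((\<lambda>d. f d * T) has_sum (S * T)) A"
    using assms(1) by (simp add: has_sum_cmult_left)
  have f: "(\<lambda>d. norm (f d)) summable_on A" "(\<lambda>e. norm (f' e)) summable_on B"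
    using assms[THEN has_sum_imp_summable, THEN summable_on_iff_abs_summable_on_real[THEN iffD1]] .
  have "(\<lambda>x. norm (case x of (d, e) \<Rightarrow> f d * f' e)) summable_on A \<times> B"
    unfolding Infinite_Sum.abs_summable_on_Sigma_iff
  proof (intro conjI ballI)
    show "(\<lambda>e. norm (case (d, e) of (d, e) \<Rightarrow> f d * f' e)) summable_on B" for d
      using f(2) by (simp add: abs_mult summable_on_cmult_right)
    have "(\<lambda>d. \<bar>f d\<bar> * infsum (\<lambda>e. \<bar>f' e\<bar>) B) summable_on A"
      using f(1) by (intro summable_on_cmult_left) simp
    moreover have "infsum (\<lambda>e. \<bar>f' e\<bar>) B \<ge> 0"
      by (intro infsum_nonneg) auto
    ultimately show "(\<lambda>d. norm (\<Sum>\<^sub>\<infinity>e\<in>B. norm (case (d, e) of (d, e) \<Rightarrow> f d * f' e))) summable_on A"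
      by (simp add: abs_mult infsum_cmult_right')
  qed
  thus "(\<lambda>(d, e). f d * f' e) summable_on A \<times> B"
    by (rule abs_summable_summable)
qed

text \<open>Cauchy product: the pairs are regrouped by their sum. Each fibre is finite, so the inner
  sums need no convergence argument.\<close>

lemma has_sum_conv3:
  fixes f f' :: "nat \<times> nat \<times> nat \<Rightarrow> real"
  assumes "(f has_sum S) UNIV" "(f' has_sum T) UNIV"
  shows "((\<lambda>e. \<Sum>d\<in>{..e}. f d * f' (e - d)) has_sum (S * T)) UNIV"
proof -
  have "((\<lambda>(d, e). f d * f' e) has_sum (S * T)) (UNIV \<times> UNIV)"
    using assms by (rule has_sum_times)
  also have "?this \<longleftrightarrow> ((\<lambda>(e, d). f d * f' (e - d)) has_sum (S * T)) (SIGMA e:UNIV. {..e})"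
    by (rule has_sum_reindex_bij_witness[of _ "\<lambda>(e, d). (d, e - d)" "\<lambda>(d, e). (d + e, d)"])
       (auto simp: triple_add_diff)
  finally show ?thesis
    by (rule has_sum_Sigma') (auto intro: has_sum_finite)
qed

section \<open>Evaluation at (1, 1, 1) and weighted l1 norms\<close>

definition eval3 :: "real fps fps fps \<Rightarrow> real" where
  "eval3 F = (\<Sum>\<^sub>\<infinity>e. coeff3 F e)"

definition abs3 :: "real \<Rightarrow> real fps fps fps \<Rightarrow> bool" where
  "abs3 r F \<longleftrightarrow> (\<lambda>e. \<bar>coeff3 F e\<bar> * r ^ size3 e) summable_on UNIV"

text \<open>The l1 norm on the polydisc of radius \<open>r\<close>. It is submultiplicative because
  \<open>size3\<close> is additive, so products and powers are controlled by their factors; if it is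
  finite for some r \<ge> 1, evaluation at (1, 1, 1) is legitimate.\<close>

definition norm3 :: "real \<Rightarrow> real fps fps fps \<Rightarrow> real" where
  "norm3 r F = (\<Sum>\<^sub>\<infinity>e. \<bar>coeff3 F e\<bar> * r ^ size3 e)"

lemma abs3_has_sum: "abs3 r F \<Longrightarrow> ((\<lambda>e. \<bar>coeff3 F e\<bar> * r ^ size3 e) has_sum norm3 r F) UNIV"
  by (simp add: abs3_def norm3_def)

lemma norm3_nonneg: "r \<ge> 0 \<Longrightarrow> norm3 r F \<ge> 0"
  unfolding norm3_def by (intro infsum_nonneg) auto

lemma abs3_summable:
  assumes "abs3 r F" "r \<ge> 1" shows "coeff3 F summable_on UNIV"
proof -
  have "(\<lambda>e. norm (coeff3 F e)) summable_on UNIV"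
  proof (rule Infinite_Sum.abs_summable_on_comparison_test')
    show "(\<lambda>e. \<bar>coeff3 F e\<bar> * r ^ size3 e) summable_on UNIV" using assms by (simp add: abs3_def)
    show "norm (coeff3 F e) \<le> \<bar>coeff3 F e\<bar> * r ^ size3 e" for e
      using assms(2) by (simp add: mult_le_cancel_left1)
  qed
  thus ?thesis by (simp add: abs_summable_summable)
qed

lemma abs3_eval: "abs3 r F \<Longrightarrow> r \<ge> 1 \<Longrightarrow> (coeff3 F has_sum eval3 F) UNIV"
  unfolding eval3_def by (intro has_sum_infsum abs3_summable)

lemma eval3_mult:
  assumes "abs3 r F" "abs3 r G" "r \<ge> 1"
  shows "eval3 (F * G) = eval3 F * eval3 G"
proof -
  have "((\<lambda>e. coeff3 (F * G) e) has_sum (eval3 F * eval3 G)) UNIV"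
    using has_sum_conv3[OF abs3_eval[OF assms(1,3)] abs3_eval[OF assms(2,3)]]
    by (simp only: coeff3_mult)
  thus ?thesis by (simp add: eval3_def infsumI)
qed

lemma abs3_norm3_mult:
  assumes "abs3 r F" "abs3 r G" "r \<ge> 0"
  shows "abs3 r (F * G)" "norm3 r (F * G) \<le> norm3 r F * norm3 r G"
proof -
  let ?h = "\<lambda>e. \<Sum>d\<in>{..e}. (\<bar>coeff3 F d\<bar> * r ^ size3 d) * (\<bar>coeff3 G (e - d)\<bar> * r ^ size3 (e - d))"
  have h: "(?h has_sum (norm3 r F * norm3 r G)) UNIV"
    by (intro has_sum_conv3 abs3_has_sum assms)
  have le: "\<bar>coeff3 (F * G) e\<bar> * r ^ size3 e \<le> ?h e" for e
  proof -
    have "\<bar>coeff3 (F * G) e\<bar> * r ^ size3 e \<le>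
            (\<Sum>d\<in>{..e}. \<bar>coeff3 F d * coeff3 G (e - d)\<bar>) * r ^ size3 e"
      unfolding coeff3_mult using assms(3) by (intro mult_right_mono sum_abs) auto
    also have "\<dots> = ?h e"
      unfolding sum_distrib_right
    proof (intro sum.cong refl)
      fix d assume "d \<in> {..e}"
      hence "size3 e = size3 d + size3 (e - d)" by (metis atMost_iff size3_add triple_add_diff)
      thus "\<bar>coeff3 F d * coeff3 G (e - d)\<bar> * r ^ size3 e =
        (\<bar>coeff3 F d\<bar> * r ^ size3 d) * (\<bar>coeff3 G (e - d)\<bar> * r ^ size3 (e - d))"
        by (simp add: abs_mult power_add)
    qed
    finally show ?thesis .
  qed
  have "(\<lambda>e. norm (\<bar>coeff3 (F * G) e\<bar> * r ^ size3 e)) summable_on UNIV"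
    by (rule Infinite_Sum.abs_summable_on_comparison_test'[OF has_sum_imp_summable[OF h]])
       (use le assms(3) in auto)
  thus "abs3 r (F * G)" unfolding abs3_def by (rule abs_summable_summable)
  from abs3_has_sum[OF this] h show "norm3 r (F * G) \<le> norm3 r F * norm3 r G"
    by (rule has_sum_mono) (use le in auto)
qed

lemma abs3_1: "abs3 r 1" and norm3_1: "norm3 r 1 = 1" and eval3_1: "eval3 1 = 1"
proof -
  have "((\<lambda>e. \<bar>coeff3 1 e\<bar> * r ^ size3 e) has_sum 1) UNIV \<longleftrightarrow>
        ((\<lambda>e. \<bar>coeff3 1 e\<bar> * r ^ size3 e) has_sum 1) {0}"
    by (intro has_sum_cong_neutral) (auto simp: coeff3_1)
  moreover have "((\<lambda>e. \<bar>coeff3 1 e\<bar> * r ^ size3 e) has_sum 1) {0}"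
    by (intro has_sum_finiteI) (auto simp: coeff3_1)
  ultimately have *: "((\<lambda>e. \<bar>coeff3 1 e\<bar> * r ^ size3 e) has_sum 1) UNIV" by simp
  thus "abs3 r 1" "norm3 r 1 = 1" by (auto simp: abs3_def norm3_def infsumI has_sum_imp_summable)
  have "(coeff3 1 has_sum 1) UNIV \<longleftrightarrow> (coeff3 1 has_sum 1) {0}"
    by (intro has_sum_cong_neutral) (auto simp: coeff3_1)
  moreover have "(coeff3 1 has_sum 1) {0}"
    by (intro has_sum_finiteI) (auto simp: coeff3_1)
  ultimately show "eval3 1 = 1" by (auto simp: eval3_def infsumI)
qed

lemma abs3_norm3_power:
  assumes "abs3 r F" "r \<ge> 0"
  shows "abs3 r (F ^ n) \<and> norm3 r (F ^ n) \<le> norm3 r F ^ n"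
proof (induction n)
  case (Suc n)
  have "norm3 r (F * F ^ n) \<le> norm3 r F * norm3 r (F ^ n)"
    using Suc assms by (intro abs3_norm3_mult) auto
  also have "\<dots> \<le> norm3 r F * norm3 r F ^ n"
    using Suc assms by (intro mult_left_mono norm3_nonneg) auto
  finally show ?case using Suc assms by (auto intro: abs3_norm3_mult)
qed (auto simp: abs3_1 norm3_1)

lemma eval3_power:
  assumes "abs3 r F" "r \<ge> 1"
  shows "eval3 (F ^ n) = eval3 F ^ n"
  using assms abs3_norm3_power[of r F]
  by (induction n) (auto simp: eval3_1 eval3_mult[where r = r])

section \<open>One-variable series inside the three-variable ring\<close>

definition var1 :: "real fps \<Rightarrow> real fps fps fps" where
  "var1 s = Abs_fps (\<lambda>a. fps_const (fps_const (fps_nth s a)))"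
definition var2 :: "real fps \<Rightarrow> real fps fps fps" where
  "var2 s = fps_const (Abs_fps (\<lambda>b. fps_const (fps_nth s b)))"
definition var3 :: "real fps \<Rightarrow> real fps fps fps" where
  "var3 s = fps_const (fps_const s)"

lemma Abs_fps_const_mult:
  fixes s t :: "'a :: comm_semiring_1 fps"
  shows "Abs_fps (\<lambda>a. fps_const (fps_nth (s * t) a)) =
    Abs_fps (\<lambda>a. fps_const (fps_nth s a)) * Abs_fps (\<lambda>a. fps_const (fps_nth t a))"
proof (rule fps_ext)
  have [simp]: "(\<Sum>i\<in>A. fps_const (f i)) = fps_const (sum f A)" for f :: "nat \<Rightarrow> 'a" and A
    by (induction A rule: infinite_finite_induct) auto
  show "fps_nth (Abs_fps (\<lambda>a. fps_const (fps_nth (s * t) a))) n =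
    fps_nth (Abs_fps (\<lambda>a. fps_const (fps_nth s a)) * Abs_fps (\<lambda>a. fps_const (fps_nth t a))) n" for n
    by (simp add: fps_mult_nth)
qed

lemma var_mult:
  "var1 (s * t) = var1 s * var1 t" "var2 (s * t) = var2 s * var2 t" "var3 (s * t) = var3 s * var3 t"
proof -
  have var1': "var1 s = Abs_fps (\<lambda>a. fps_const (fps_nth (Abs_fps (\<lambda>a. fps_const (fps_nth s a))) a))" for s
    by (simp add: var1_def)
  show "var1 (s * t) = var1 s * var1 t"
    unfolding var1' by (simp only: Abs_fps_const_mult)
qed (simp_all add: var2_def var3_def Abs_fps_const_mult)

lemma var_1 [simp]: "var1 1 = 1" "var2 1 = 1" "var3 1 = 1"
  by (rule coeff3_eqI; auto simp: coeff3_def var1_def var2_def var3_def split: prod.splits)+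

lemma var_power: "var1 (s ^ n) = var1 s ^ n" "var2 (s ^ n) = var2 s ^ n" "var3 (s ^ n) = var3 s ^ n"
  by (induction n) (simp_all add: var_mult)

lemma coeff3_var_mult:
  "coeff3 (var1 s * var2 t * var3 u) (a, b, c) = fps_nth s a * fps_nth t b * fps_nth u c"
  by (simp add: coeff3_def var1_def var2_def var3_def)

lemma has_sum_triple:
  fixes f f' f'' :: "nat \<Rightarrow> real"
  assumes "(f has_sum S) UNIV" "(f' has_sum T) UNIV" "(f'' has_sum U) UNIV"
  shows "((\<lambda>(a, b, c). f a * f' b * f'' c) has_sum (S * T * U)) UNIV"
  using has_sum_times[OF assms(1) has_sum_times[OF assms(2,3)]]
  by (simp add: case_prod_unfold mult.assoc)

lemma norm3_var_mult:
  assumes "((\<lambda>n. \<bar>fps_nth s n\<bar> * r ^ n) has_sum S) UNIV"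
    "((\<lambda>n. \<bar>fps_nth t n\<bar> * r ^ n) has_sum T) UNIV"
    "((\<lambda>n. \<bar>fps_nth u n\<bar> * r ^ n) has_sum U) UNIV"
  shows "abs3 r (var1 s * var2 t * var3 u)" "norm3 r (var1 s * var2 t * var3 u) = S * T * U"
proof -
  let ?F = "var1 s * var2 t * var3 u"
  have "((\<lambda>e. \<bar>coeff3 ?F e\<bar> * r ^ size3 e) has_sum (S * T * U)) UNIV"
    using has_sum_triple[OF assms]
    by (rule has_sum_cong[THEN iffD1, rotated])
       (auto simp: coeff3_var_mult abs_mult power_add)
  thus "abs3 r ?F" "norm3 r ?F = S * T * U"
    by (auto simp: abs3_def norm3_def infsumI has_sum_imp_summable)
qed

lemma eval3_var_mult:
  assumes "(fps_nth s has_sum S) UNIV" "(fps_nth t has_sum T) UNIV" "(fps_nth u has_sum U) UNIV"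
  shows "eval3 (var1 s * var2 t * var3 u) = S * T * U"
proof -
  have "(coeff3 (var1 s * var2 t * var3 u) has_sum (S * T * U)) UNIV"
    using has_sum_triple[OF assms]
    by (rule has_sum_cong[THEN iffD1, rotated]) (auto simp: coeff3_var_mult)
  thus ?thesis by (simp add: eval3_def infsumI)
qed

lemma has_sum_fps_one: "((\<lambda>n. \<bar>fps_nth (1 :: real fps) n\<bar> * r ^ n) has_sum 1) UNIV"
proof -
  have "((\<lambda>n. \<bar>fps_nth (1 :: real fps) n\<bar> * r ^ n) has_sum 1) {0}"
    by (intro has_sum_finiteI) auto
  thus ?thesis by (rule has_sum_cong_neutral[THEN iffD1, rotated -1]) auto
qed

lemma has_sum_fps_one': "(fps_nth (1 :: real fps) has_sum 1) UNIV"
proof -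
  have "(fps_nth (1 :: real fps) has_sum 1) {0}"
    by (intro has_sum_finiteI) auto
  thus ?thesis by (rule has_sum_cong_neutral[THEN iffD1, rotated -1]) auto
qed

lemma norm3_var:
  assumes "((\<lambda>n. \<bar>fps_nth s n\<bar> * r ^ n) has_sum S) UNIV"
  shows "abs3 r (var1 s)" "norm3 r (var1 s) = S" "abs3 r (var2 s)" "norm3 r (var2 s) = S"
    "abs3 r (var3 s)" "norm3 r (var3 s) = S"
  using norm3_var_mult[OF assms has_sum_fps_one has_sum_fps_one]
    norm3_var_mult[OF has_sum_fps_one assms has_sum_fps_one]
    norm3_var_mult[OF has_sum_fps_one has_sum_fps_one assms] by simp_all

lemma eval3_var:
  assumes "(fps_nth s has_sum S) UNIV"
  shows "eval3 (var1 s) = S" "eval3 (var2 s) = S" "eval3 (var3 s) = S"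
  using eval3_var_mult[OF assms has_sum_fps_one' has_sum_fps_one']
    eval3_var_mult[OF has_sum_fps_one' assms has_sum_fps_one']
    eval3_var_mult[OF has_sum_fps_one' has_sum_fps_one' assms] by simp_all

text \<open>The series 1 / (1 - c X). For c = 1 / p the coefficient of X^n in its k-th power is
  d_k(p^n) / p^n.\<close>

definition geo :: "real \<Rightarrow> real fps" where "geo c = Abs_fps (\<lambda>n. c ^ n)"

text \<open>Writing the inverse as a polynomial makes its norm a sum of two terms, finite at every
  radius.\<close>

definition geo_inv :: "real \<Rightarrow> real fps" where "geo_inv c = 1 - fps_const c * fps_X"

lemma geo_mult_inv: "geo c * geo_inv c = 1"
proof (rule fps_ext)
  have "geo c * geo_inv c = geo c - fps_const c * (geo c * fps_X)"
    by (simp add: geo_inv_def algebra_simps)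
  thus "fps_nth (geo c * geo_inv c) n = fps_nth 1 n" for n
    by (cases n) (simp_all add: geo_def fps_X_mult_right_nth)
qed

lemma has_sum_geo:
  assumes "0 \<le> c" "0 \<le> r" "c * r < 1"
  shows "((\<lambda>n. \<bar>fps_nth (geo c) n\<bar> * r ^ n) has_sum (1 / (1 - c * r))) UNIV"
proof -
  have "((\<lambda>n. (c * r) ^ n) has_sum (1 / (1 - c * r))) UNIV"
    using assms geometric_sums[of "c * r"]
    by (intro norm_summable_imp_has_sum) (auto simp: summable_geometric norm_power abs_mult)
  thus ?thesis using assms by (simp add: geo_def power_mult_distrib)
qed

lemma has_sum_geo_inv:
  assumes "0 \<le> c" 
  shows "((\<lambda>n. \<bar>fps_nth (geo_inv c) n\<bar> * r ^ n) has_sum (1 + c * r)) UNIV"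
proof -
  have "((\<lambda>n. \<bar>fps_nth (geo_inv c) n\<bar> * r ^ n) has_sum (1 + c * r)) {0,1}"
    using assms by (intro has_sum_finiteI) (auto simp: geo_inv_def)
  thus ?thesis
    by (rule has_sum_cong_neutral[THEN iffD1, rotated -1]) (auto simp: geo_inv_def fps_X_nth)
qed

lemma has_sum_geo': "0 \<le> c \<Longrightarrow> c < 1 \<Longrightarrow> ((\<lambda>n. fps_nth (geo c) n) has_sum (1 / (1 - c))) UNIV"
  using has_sum_geo[of c 1] unfolding geo_def fps_nth_Abs_fps by simp

lemma has_sum_geo_inv': "(fps_nth (geo_inv c) has_sum (1 - c)) UNIV"
proof -
  have "(fps_nth (geo_inv c) has_sum (1 - c)) {0,1}"
    by (intro has_sum_finiteI) (auto simp: geo_inv_def)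
  thus ?thesis
    by (rule has_sum_cong_neutral[THEN iffD1, rotated -1]) (auto simp: geo_inv_def fps_X_nth)
qed

definition pow3 :: "nat \<Rightarrow> nat \<Rightarrow> nat \<Rightarrow> real fps \<Rightarrow> real fps fps fps" where
  "pow3 K L M s = var1 (s ^ K) * var2 (s ^ L) * var3 (s ^ M)"

lemma pow3_mult: "pow3 K L M s * pow3 K L M t = pow3 K L M (s * t)"
  by (simp add: pow3_def power_mult_distrib var_mult mult_ac)

lemma pow3_1 [simp]: "pow3 K L M 1 = 1"
  by (simp add: pow3_def)

lemma abs3_pow3:
  assumes "((\<lambda>n. \<bar>fps_nth s n\<bar> * r ^ n) has_sum S) UNIV" "r \<ge> 0"
  shows "abs3 r (pow3 K L M s)" "norm3 r (pow3 K L M s) \<le> S ^ (K + L + M)"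
proof -
  note v = norm3_var[OF assms(1)]
  note p = abs3_norm3_power[OF v(1) assms(2), of K] abs3_norm3_power[OF v(3) assms(2), of L]
    abs3_norm3_power[OF v(5) assms(2), of M]
  have S: "S \<ge> 0" using v(2) norm3_nonneg[OF assms(2)] by metis
  have 1: "abs3 r (var1 s ^ K * var2 s ^ L)" using p assms(2) by (intro abs3_norm3_mult) auto
  thus "abs3 r (pow3 K L M s)"
    unfolding pow3_def var_power using p assms(2) by (intro abs3_norm3_mult) auto
  have "norm3 r (pow3 K L M s) \<le> norm3 r (var1 s ^ K * var2 s ^ L) * norm3 r (var3 s ^ M)"
    unfolding pow3_def var_power using p 1 assms(2) by (intro abs3_norm3_mult) auto
  also have "\<dots> \<le> (norm3 r (var1 s ^ K) * norm3 r (var2 s ^ L)) * norm3 r (var3 s ^ M)"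
    using p assms(2) by (intro mult_right_mono abs3_norm3_mult norm3_nonneg) auto
  also have "\<dots> \<le> (S ^ K * S ^ L) * S ^ M"
    using p assms(2) S unfolding v by (intro mult_mono norm3_nonneg mult_nonneg_nonneg) auto
  finally show "norm3 r (pow3 K L M s) \<le> S ^ (K + L + M)"
    by (simp add: power_add)
qed

lemma eval3_pow3:
  assumes "((\<lambda>n. \<bar>fps_nth s n\<bar> * r ^ n) has_sum S') UNIV" "(fps_nth s has_sum S) UNIV" "r \<ge> 1"
  shows "eval3 (pow3 K L M s) = S ^ (K + L + M)"
proof -
  note v = norm3_var[OF assms(1)]
  have r: "r \<ge> 0" using assms(3) by simp
  note p = abs3_norm3_power[OF v(1) r, of K] abs3_norm3_power[OF v(3) r, of L]
    abs3_norm3_power[OF v(5) r, of M]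
  have 1: "abs3 r (var1 s ^ K * var2 s ^ L)" using p r by (intro abs3_norm3_mult) auto
  show ?thesis
    unfolding pow3_def var_power using p 1 assms
    by (simp add: eval3_mult[where r = r] eval3_power[where r = r] v eval3_var[OF assms(2)] power_add)
qed

section \<open>Multiplicative functions of three variables\<close>

definition mult3 :: "nat \<Rightarrow> nat \<times> nat \<times> nat \<Rightarrow> nat \<times> nat \<times> nat" where
  "mult3 p = (\<lambda>(u, v, w). (multiplicity p u, multiplicity p v, multiplicity p w))"

definition pos3 :: "(nat \<times> nat \<times> nat) set" where
  "pos3 = {(u, v, w). 0 < u \<and> 0 < v \<and> 0 < w}"

definition prod3 :: "nat \<times> nat \<times> nat \<Rightarrow> nat" where
  "prod3 = (\<lambda>(u, v, w). u * v * w)"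

text \<open>The index set that results from expanding a product over \<open>P\<close> of sums over
  \<open>B p\<close>. The divisors of a triple, the terms of a truncated Euler product and a cover
  of an arbitrary finite set of triples are all of this shape.\<close>

definition box3 :: "nat set \<Rightarrow> (nat \<Rightarrow> (nat \<times> nat \<times> nat) set) \<Rightarrow> (nat \<times> nat \<times> nat) set" where
  "box3 P B = {t \<in> pos3. prime_factors (prod3 t) \<subseteq> P \<and> (\<forall>p\<in>P. mult3 p t \<in> B p)}"

definition divisors3 :: "nat \<times> nat \<times> nat \<Rightarrow> (nat \<times> nat \<times> nat) set" where
  "divisors3 = (\<lambda>(u, v, w). {a. a dvd u} \<times> {b. b dvd v} \<times> {c. c dvd w})"

definition pow_prod :: "nat set \<Rightarrow> (nat \<Rightarrow> nat \<times> nat \<times> nat) \<Rightarrow> nat \<times> nat \<times> nat" where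
  "pow_prod P e = (\<Prod>p\<in>P. p ^ fst (e p), \<Prod>p\<in>P. p ^ fst (snd (e p)), \<Prod>p\<in>P. p ^ snd (snd (e p)))"

lemma pos3_prod3: "t \<in> pos3 \<longleftrightarrow> prod3 t > 0"
  by (cases t) (auto simp: pos3_def prod3_def)

lemma multiplicity_eq_0_iff_nat:
  "prime p \<Longrightarrow> n > (0::nat) \<Longrightarrow> multiplicity p n = 0 \<longleftrightarrow> \<not> p dvd n"
  by (metis gr0I less_not_refl prime_multiplicity_gt_zero_iff prime_imp_prime_elem)

lemma prime_factors_prod3:
  "t \<in> pos3 \<Longrightarrow> prime p \<Longrightarrow> p \<in> prime_factors (prod3 t) \<longleftrightarrow> mult3 p t \<noteq> 0"
  by (auto simp: pos3_def prod3_def mult3_def zero_prod_def prime_factors_dvd prime_dvd_mult_iff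
      multiplicity_eq_0_iff_nat)

lemma prod_multiplicity:
  assumes "finite P" "\<And>p. p \<in> P \<Longrightarrow> prime p" "prime_factors n \<subseteq> P" "n > (0::nat)"
  shows "(\<Prod>p\<in>P. p ^ multiplicity p n) = n"
proof -
  have "n = (\<Prod>p\<in>prime_factors n. p ^ multiplicity p n)"
    using assms(4) by (intro prime_factorization_nat) auto
  also have "\<dots> = (\<Prod>p\<in>P. p ^ multiplicity p n)"
    using assms by (intro prod.mono_neutral_left) (auto simp: prime_factors_multiplicity)
  finally show ?thesis ..
qed

lemma mult3_pow_prod:
  assumes "finite P" "\<And>p. p \<in> P \<Longrightarrow> prime p" "prime p"
  shows "mult3 p (pow_prod P e) = (if p \<in> P then e p else 0)"
  using assms by (auto simp: mult3_def pow_prod_def zero_prod_def multiplicity_prod_prime_powers)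

lemma pow_prod_pos3:
  assumes "finite P" "\<And>p. p \<in> P \<Longrightarrow> prime p"
  shows "pow_prod P e \<in> pos3"
  using assms by (auto simp: pos3_def pow_prod_def prod_pos prime_gt_0_nat)

lemma pow_prod_mult3:
  assumes "finite P" "\<And>p. p \<in> P \<Longrightarrow> prime p" "prime_factors (prod3 t) \<subseteq> P" "t \<in> pos3"
  shows "pow_prod P (\<lambda>p. mult3 p t) = t"
proof -
  obtain u v w where t: "t = (u, v, w)" by (cases t)
  have "prime_factors u \<subseteq> P" "prime_factors v \<subseteq> P" "prime_factors w \<subseteq> P"
    using assms(3,4) by (auto simp: t prod3_def pos3_def prime_factors_dvd subset_iff)
  thus ?thesis using assms(4) prod_multiplicity[OF assms(1,2)]
    by (simp add: t pow_prod_def mult3_def pos3_def)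
qed

text \<open>Unique factorization: exponents at the primes of \<open>P\<close> can be prescribed
  independently, and they determine a triple composed of these primes.\<close>

lemma bij_betw_box3:
  assumes "finite P" "\<And>p. p \<in> P \<Longrightarrow> prime p"
  shows "bij_betw (pow_prod P) (PiE P B) (box3 P B)"
proof (rule bij_betw_byWitness[where f' = "\<lambda>t. \<lambda>p\<in>P. mult3 p t"])
  show "\<forall>e\<in>PiE P B. (\<lambda>p\<in>P. mult3 p (pow_prod P e)) = e"
    using assms by (auto simp: fun_eq_iff mult3_pow_prod restrict_def PiE_def extensional_def)
  have "pow_prod P (\<lambda>p\<in>P. mult3 p t) = pow_prod P (\<lambda>p. mult3 p t)" for t
    by (simp add: pow_prod_def)
  thus "\<forall>t\<in>box3 P B. pow_prod P (\<lambda>p\<in>P. mult3 p t) = t"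
    using assms pow_prod_mult3 by (auto simp: box3_def)
  have "prime_factors (prod3 (pow_prod P e)) \<subseteq> P" for e
    using assms pow_prod_pos3[OF assms, of e]
    by (metis in_prime_factors_imp_prime mult3_pow_prod prime_factors_prod3 subsetI)
  moreover have "mult3 p (pow_prod P e) \<in> B p" if "e \<in> PiE P B" "p \<in> P" for p e
    using that assms by (auto simp: mult3_pow_prod)
  ultimately show "pow_prod P ` PiE P B \<subseteq> box3 P B"
    using pow_prod_pos3[OF assms] unfolding box3_def by blast
  show "(\<lambda>t. \<lambda>p\<in>P. mult3 p t) ` box3 P B \<subseteq> PiE P B"
    by (auto simp: box3_def)
qed

lemma finite_box3:
  assumes "finite P" "\<And>p. p \<in> P \<Longrightarrow> prime p" "\<And>p. p \<in> P \<Longrightarrow> finite (B p)"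
  shows "finite (box3 P B)"
  using bij_betw_finite[OF bij_betw_box3[OF assms(1,2)], of B] assms by (simp add: finite_PiE)

lemma sum_box3:
  fixes f :: "nat \<Rightarrow> nat \<times> nat \<times> nat \<Rightarrow> real"
  assumes "finite P" "\<And>p. p \<in> P \<Longrightarrow> prime p" "\<And>p. p \<in> P \<Longrightarrow> finite (B p)"
  shows "(\<Sum>t\<in>box3 P B. \<Prod>p\<in>P. f p (mult3 p t)) = (\<Prod>p\<in>P. \<Sum>e\<in>B p. f p e)"
proof -
  have "(\<Prod>p\<in>P. \<Sum>e\<in>B p. f p e) = (\<Sum>e\<in>PiE P B. \<Prod>p\<in>P. f p (e p))"
    using assms by (intro prod_sum_PiE) auto
  also have "\<dots> = (\<Sum>e\<in>PiE P B. \<Prod>p\<in>P. f p (mult3 p (pow_prod P e)))"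
    using assms by (intro sum.cong prod.cong refl) (auto simp: mult3_pow_prod)
  also have "\<dots> = (\<Sum>t\<in>box3 P B. \<Prod>p\<in>P. f p (mult3 p t))"
    by (rule sum.reindex_bij_betw[OF bij_betw_box3[OF assms(1,2)]])
  finally show ?thesis ..
qed

lemma divisors3_pos3: "t \<in> pos3 \<Longrightarrow> d \<in> divisors3 t \<Longrightarrow> d \<in> pos3"
  by (auto simp: pos3_def divisors3_def intro: Nat.gr0I)

lemma divisors3_iff:
  assumes "t \<in> pos3" "d \<in> pos3"
  shows "d \<in> divisors3 t \<longleftrightarrow> (\<forall>p. prime p \<longrightarrow> mult3 p d \<le> mult3 p t)"
  using assms by (auto simp: pos3_def divisors3_def mult3_def prime_multiplicity_le_imp_dvd)

lemma prime_factors_divisors3: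
  assumes "t \<in> pos3" "d \<in> divisors3 t"
  shows "prime_factors (prod3 d) \<subseteq> prime_factors (prod3 t)"
  using assms by (intro dvd_prime_factors) (auto simp: pos3_def divisors3_def prod3_def intro!: mult_dvd_mono)

text \<open>At a prime outside \<open>P\<close> the exponents of both triples vanish, so
  divisibility is a condition at the primes of \<open>P\<close> alone.\<close>

lemma divisors3_eq_box3:
  assumes "\<And>p. p \<in> P \<Longrightarrow> prime p" "prime_factors (prod3 t) \<subseteq> P" "t \<in> pos3"
  shows "divisors3 t = box3 P (\<lambda>p. {..mult3 p t})"
proof (intro set_eqI iffI)
  fix d assume d: "d \<in> divisors3 t"
  thus "d \<in> box3 P (\<lambda>p. {..mult3 p t})"
    using assms divisors3_pos3[OF assms(3) d] divisors3_iff[of t d] prime_factors_divisors3[of t d]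
    by (auto simp: box3_def)
next
  fix d assume d: "d \<in> box3 P (\<lambda>p. {..mult3 p t})"
  have "mult3 p d \<le> mult3 p t" if "prime p" for p
  proof (cases "p \<in> P")
    case False
    hence "mult3 p d = 0" using d that prime_factors_prod3[of d p] by (auto simp: box3_def)
    thus ?thesis by (cases "mult3 p t") (auto simp: zero_prod_def)
  qed (use d in \<open>auto simp: box3_def\<close>)
  thus "d \<in> divisors3 t"
    using assms(3) d by (subst divisors3_iff) (auto simp: box3_def)
qed

lemma sum_divisors3:
  fixes f :: "nat \<Rightarrow> nat \<times> nat \<times> nat \<Rightarrow> real"
  assumes "finite P" "\<And>p. p \<in> P \<Longrightarrow> prime p" "prime_factors (prod3 t) \<subseteq> P" "t \<in> pos3"
  shows "(\<Sum>d\<in>divisors3 t. \<Prod>p\<in>P. f p (mult3 p d)) = (\<Prod>p\<in>P. \<Sum>e\<le>mult3 p t. f p e)"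
  using assms by (subst divisors3_eq_box3[OF assms(2-4)], simp, subst sum_box3) auto

text \<open>The one-variable case, read off from the divisors of \<open>(n, 1, 1)\<close>.\<close>

lemma sum_divisors:
  fixes f :: "nat \<Rightarrow> nat \<Rightarrow> real"
  assumes "finite P" "\<And>p. p \<in> P \<Longrightarrow> prime p" "prime_factors n \<subseteq> P" "n > 0"
  shows "(\<Sum>d | d dvd n. \<Prod>p\<in>P. f p (multiplicity p d)) = (\<Prod>p\<in>P. \<Sum>i\<le>multiplicity p n. f p i)"
proof -
  have "(\<Sum>d | d dvd n. \<Prod>p\<in>P. f p (multiplicity p d)) =
    (\<Sum>t\<in>divisors3 (n, 1, 1). \<Prod>p\<in>P. f p (fst (mult3 p t)))"
    by (rule sum.reindex_bij_witness[of _ fst "\<lambda>d. (d, 1, 1)"])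
       (auto simp: divisors3_def mult3_def)
  also have "\<dots> = (\<Prod>p\<in>P. \<Sum>e\<le>mult3 p (n, 1, 1). f p (fst e))"
    using assms by (intro sum_divisors3) (auto simp: prod3_def pos3_def)
  also have "\<dots> = (\<Prod>p\<in>P. \<Sum>i\<le>multiplicity p n. f p i)"
    by (intro prod.cong refl sum.reindex_bij_witness[of _ "\<lambda>i. (i, 0, 0)" fst])
       (auto simp: mult3_def)
  finally show ?thesis .
qed

section \<open>The divisor functions as products over primes\<close>

lemma finite_divisor_lists: "n > 0 \<Longrightarrow>
  finite {xs :: nat list. length xs = k \<and> (\<forall>x\<in>set xs. x > 0) \<and> prod_list xs = n}"
proof (rule finite_subset)
  assume n: "n > 0"
  have "x \<le> prod_list xs" if "x \<in> set xs" "\<forall>x\<in>set xs. x > 0" for x :: nat and xs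
    using that by (intro dvd_imp_le prod_list_dvd) (auto simp: prod_list_zero_iff intro!: Nat.gr0I)
  thus "{xs. length xs = k \<and> (\<forall>x\<in>set xs. x > 0) \<and> prod_list xs = n} \<subseteq>
    {xs. set xs \<subseteq> {..n} \<and> length xs = k}" by auto
qed (intro finite_lists_length_eq, simp)

lemma divisor_fun_0: "divisor_fun 0 n = (if n = 1 then 1 else 0)"
proof -
  have "{xs :: nat list. length xs = 0 \<and> (\<forall>x\<in>set xs. x > 0) \<and> prod_list xs = n} =
    (if n = 1 then {[]} else {})" by auto
  thus ?thesis by (simp add: divisor_fun_def)
qed

text \<open>Split off the head of the list: it is forced to be \<open>n div d\<close>, where
  \<open>d\<close> is the product of the tail, and the tail is an arbitrary factorization of
  \<open>d\<close>.\<close>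

lemma divisor_fun_Suc:
  assumes "n > 0"
  shows "divisor_fun (Suc k) n = (\<Sum>d | d dvd n. divisor_fun k d)"
proof -
  let ?S = "\<lambda>k n. {xs :: nat list. length xs = k \<and> (\<forall>x\<in>set xs. x > 0) \<and> prod_list xs = n}"
  have pos: "n div d > 0" if "d dvd n" for d
    using assms that by (metis dvd_div_eq_0_iff gr0I less_not_refl)
  have "bij_betw (\<lambda>xs. (prod_list (tl xs), tl xs)) (?S (Suc k) n) (SIGMA d:{d. d dvd n}. ?S k d)"
  proof (rule bij_betw_byWitness[where f' = "\<lambda>(d, ys). (n div d) # ys"])
    show "\<forall>xs\<in>?S (Suc k) n. (\<lambda>(d, ys). (n div d) # ys) (prod_list (tl xs), tl xs) = xs"
      using assms by (auto simp: length_Suc_conv)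
    show "(\<lambda>(d, ys). (n div d) # ys) ` (SIGMA d:{d. d dvd n}. ?S k d) \<subseteq> ?S (Suc k) n"
      using pos by auto
  qed (auto simp: length_Suc_conv)
  hence "card (?S (Suc k) n) = card (SIGMA d:{d. d dvd n}. ?S k d)" by (rule bij_betw_same_card)
  also have "\<dots> = (\<Sum>d | d dvd n. card (?S k d))"
    using assms by (intro card_SigmaI finite_divisors_nat ballI finite_divisor_lists)
      (auto intro!: Nat.gr0I)
  finally show ?thesis by (simp add: divisor_fun_def)
qed

text \<open>Since d_(k+1) is the convolution of d_k with 1, each induction step multiplies every
  local factor by one more \<open>geo\<close>. Letting \<open>P\<close> exceed the primes of
  \<open>n\<close> allows an integer and its divisors to be expanded over the same primes.\<close>

lemma divisor_fun_multiplicative: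
  assumes "finite P" "\<And>p. p \<in> P \<Longrightarrow> prime p" "prime_factors n \<subseteq> P" "n > 0"
  shows "real (divisor_fun k n) / real n = (\<Prod>p\<in>P. fps_nth (geo (1 / real p) ^ k) (multiplicity p n))"
  using assms(3,4)
proof (induction k arbitrary: n)
  case (0 n)
  show ?case
  proof (cases "n = 1")
    case False
    then obtain p where p: "prime p" "p dvd n" by (metis prime_factor_nat)
    hence "p \<in> P" "multiplicity p n \<noteq> 0" using 0 by (auto simp: prime_factors_dvd multiplicity_eq_0_iff_nat)
    thus ?thesis using False assms(1) by (auto simp: divisor_fun_0 intro!: prod_zero)
  qed (auto simp: divisor_fun_0)
next
  case (Suc k n)
  \<comment> \<open>The weight of the cofactor \<open>n div d\<close>; its local factors are
    coefficients of \<open>geo (1 / real p)\<close>.\<close>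
  have quot: "real d / real n = (\<Prod>p\<in>P. (1 / real p) ^ (multiplicity p n - multiplicity p d))"
    if d: "d dvd n" for d
  proof -
    have d0: "d > 0" "prime_factors d \<subseteq> P"
      using d Suc.prems dvd_prime_factors[of n d] by (auto intro!: Nat.gr0I)
    have "real d / real n = real (\<Prod>p\<in>P. p ^ multiplicity p d) / real (\<Prod>p\<in>P. p ^ multiplicity p n)"
      using prod_multiplicity[OF assms(1,2)] d0 Suc.prems by simp
    also have "\<dots> = (\<Prod>p\<in>P. real p ^ multiplicity p d / real p ^ multiplicity p n)"
      by (simp add: prod_dividef)
    also have "\<dots> = (\<Prod>p\<in>P. (1 / real p) ^ (multiplicity p n - multiplicity p d))"
    proof (intro prod.cong refl)
      fix p assume p: "p \<in> P"
      have "multiplicity p d \<le> multiplicity p n" using d Suc.prems by (intro dvd_imp_multiplicity_le) auto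
      moreover have "real p \<noteq> 0" using assms(2)[OF p] by (auto dest: prime_gt_0_nat)
      ultimately show "real p ^ multiplicity p d / real p ^ multiplicity p n =
          (1 / real p) ^ (multiplicity p n - multiplicity p d)"
        by (simp add: power_diff field_simps)
    qed
    finally show ?thesis .
  qed
  have "real (divisor_fun (Suc k) n) / real n =
     (\<Sum>d | d dvd n. real (divisor_fun k d) / real d * (real d / real n))"
    using Suc.prems by (subst divisor_fun_Suc) (auto simp: sum_divide_distrib intro!: sum.cong)
  also have "\<dots> = (\<Sum>d | d dvd n. \<Prod>p\<in>P. fps_nth (geo (1 / real p) ^ k) (multiplicity p d) *
      (1 / real p) ^ (multiplicity p n - multiplicity p d))"
  proof (intro sum.cong refl)
    fix d assume d: "d \<in> {d. d dvd n}"
    hence d0: "d > 0" "prime_factors d \<subseteq> P"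
      using Suc.prems dvd_prime_factors[of n d] by (auto intro!: Nat.gr0I)
    show "real (divisor_fun k d) / real d * (real d / real n) =
      (\<Prod>p\<in>P. fps_nth (geo (1 / real p) ^ k) (multiplicity p d) *
      (1 / real p) ^ (multiplicity p n - multiplicity p d))"
      using d by (subst Suc.IH[OF d0(2,1)], subst quot) (auto simp: prod.distrib)
  qed
  also have "\<dots> = (\<Prod>p\<in>P. \<Sum>i\<le>multiplicity p n. fps_nth (geo (1 / real p) ^ k) i *
      (1 / real p) ^ (multiplicity p n - i))"
    using assms(1,2) Suc.prems
    by (intro sum_divisors[where f = "\<lambda>p i. fps_nth (geo (1 / real p) ^ k) i * (1 / real p) ^ (multiplicity p n - i)"])
  also have "\<dots> = (\<Prod>p\<in>P. fps_nth (geo (1 / real p) ^ Suc k) (multiplicity p n))"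
    by (simp add: power_Suc2 fps_mult_nth geo_def atLeast0AtMost del: power_Suc)
  finally show ?case .
qed

lemma divisor_fun_prime_power:
  assumes "prime p"
  shows "real (divisor_fun k (p ^ a)) / real (p ^ a) = fps_nth (geo (1 / real p) ^ k) a"
proof -
  have "prime_factors (p ^ a) \<subseteq> {p}"
  proof
    fix q assume "q \<in> prime_factors (p ^ a)"
    hence "prime q" "q dvd p ^ a" by auto
    thus "q \<in> {p}" using prime_dvd_power primes_dvd_imp_eq assms by blast
  qed
  moreover have "multiplicity p (p ^ a) = a"
    using assms not_prime_unit by (intro multiplicity_same_power) auto
  ultimately show ?thesis
    using divisor_fun_multiplicative[of "{p}" "p ^ a" k] assms prime_gt_0_nat[of p]
    by (simp del: of_nat_power)
qed

section \<open>Solvability of the congruences and the factor \<open>corr\<close>\<close>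

lemma cong_solvable_iff:
  fixes a b :: int
  shows "(\<exists>n. [n = a] (mod u) \<and> [n = b] (mod v)) \<longleftrightarrow> gcd u v dvd a - b"
proof
  assume "\<exists>n. [n = a] (mod u) \<and> [n = b] (mod v)"
  then obtain n where "[n = a] (mod u)" "[n = b] (mod v)" by blast
  hence "gcd u v dvd n - b" "gcd u v dvd n - a"
    by (meson cong_iff_dvd_diff dvd_trans gcd_dvd1 gcd_dvd2)+
  hence "gcd u v dvd (n - b) - (n - a)" by (rule dvd_diff)
  thus "gcd u v dvd a - b" by simp
next
  assume "gcd u v dvd a - b"
  then obtain q where q: "a - b = gcd u v * q" by auto
  obtain x y where xy: "x * u + y * v = gcd u v" using bezout_int by blast
  have "a - b = u * (x * q) + v * (y * q)" unfolding q xy[symmetric] by (simp add: algebra_simps)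
  hence "a - u * (x * q) - a = u * (- (x * q))" "a - u * (x * q) - b = v * (y * q)" by auto
  hence "[a - u * (x * q) = a] (mod u)" "[a - u * (x * q) = b] (mod v)"
    unfolding cong_iff_dvd_diff by (metis dvd_triv_left)+
  thus "\<exists>n. [n = a] (mod u) \<and> [n = b] (mod v)" by blast
qed

text \<open>Pairwise compatibility suffices because the divisor lattice is distributive: once the
  first two congruences are solved, the third has to agree with them modulo the gcd of
  \<open>lcm u v\<close> and \<open>w\<close>, which is the lcm of \<open>gcd u w\<close> and
  \<open>gcd v w\<close>. The \<open>2 * h\<close> comes from the residues -h and h of the outer
  pair.\<close>

lemma g_eq:
  "g h u v w = (if gcd u v dvd h \<and> gcd v w dvd h \<and> gcd u w dvd 2 * h then 1 else 0)"
proof -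
  have "(\<exists>n::int. [n = - int h] (mod int u) \<and> [n = 0] (mod int v) \<and> [n = int h] (mod int w)) \<longleftrightarrow>
    gcd u v dvd h \<and> gcd v w dvd h \<and> gcd u w dvd 2 * h" (is "?L \<longleftrightarrow> ?R")
  proof
    assume ?L
    then obtain n where n: "[n = - int h] (mod int u)" "[n = 0] (mod int v)" "[n = int h] (mod int w)"
      by blast
    have "gcd (int u) (int v) dvd - int h - 0" "gcd (int v) (int w) dvd 0 - int h"
      "gcd (int u) (int w) dvd - int h - int h"
      using n by (intro cong_solvable_iff[THEN iffD1]; blast)+
    moreover have "- int h - int h = - int (2 * h)" by simp
    ultimately show ?R by (auto simp: gcd_int_int_eq simp del: of_nat_mult)
  next
    assume R: ?R
    have "gcd (int u) (int v) dvd - int h - 0" using R by (simp add: gcd_int_int_eq)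
    then obtain n where n: "[n = - int h] (mod int u)" "[n = 0] (mod int v)"
      using cong_solvable_iff by blast
    have "int (gcd u w) dvd n - int h"
    proof -
      have "int (gcd u w) dvd n - (- int h)" using n(1)
        by (meson cong_iff_dvd_diff dvd_trans gcd_dvd1 of_nat_dvd_iff)
      moreover have "int (gcd u w) dvd int (2 * h)" using R by (simp only: of_nat_dvd_iff)
      ultimately have "int (gcd u w) dvd (n - (- int h)) - int (2 * h)" by (rule dvd_diff)
      thus ?thesis by simp
    qed
    moreover have "int (gcd v w) dvd n - int h"
    proof -
      have "int (gcd v w) dvd n" using n(2)
        by (metis cong_0_iff dvd_trans gcd_dvd1 of_nat_dvd_iff)
      moreover have "int (gcd v w) dvd int h" using R by (simp only: of_nat_dvd_iff)
      ultimately show ?thesis by (rule dvd_diff)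
    qed
    ultimately have "lcm (int (gcd u w)) (int (gcd v w)) dvd n - int h" by (rule lcm_least)
    moreover have "lcm (int (gcd u w)) (int (gcd v w)) = gcd (lcm (int u) (int v)) (int w)"
      using gcd_lcm_distrib[of w u v] by (simp add: gcd_int_int_eq lcm_int_int_eq gcd.commute)
    ultimately obtain n' where n': "[n' = n] (mod lcm (int u) (int v))" "[n' = int h] (mod int w)"
      using cong_solvable_iff by metis
    have "[n' = n] (mod int u)" "[n' = n] (mod int v)"
      using n'(1) by (meson cong_dvd_modulus dvd_lcm1 dvd_lcm2)+
    thus ?L using n n'(2) by (meson cong_trans)
  qed
  thus ?thesis by (simp add: g_def)
qed

text \<open>The ratio of the summand and the product of the terms \<open>d n / n\<close>.\<close>

definition corr :: "nat \<Rightarrow> nat \<times> nat \<times> nat \<Rightarrow> real" where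
  "corr h = (\<lambda>(u, v, w). g h u v w * real (u * v * w) / real (lcm3 u v w))"

definition prime_pow3 :: "nat \<Rightarrow> nat \<times> nat \<times> nat \<Rightarrow> nat \<times> nat \<times> nat" where
  "prime_pow3 p = (\<lambda>(a, b, c). (p ^ a, p ^ b, p ^ c))"

lemma gcd_prime_powers: "gcd (p ^ a) (p ^ b) = (p ^ min a b :: nat)"
  by (metis (no_types, lifting) gcd_nat.absorb1 gcd_nat.absorb2 le_imp_power_dvd min.absorb1 min.absorb2 nat_le_linear)

lemma lcm_prime_powers: "lcm (p ^ a) (p ^ b) = (p ^ max a b :: nat)"
  by (metis (no_types, lifting) lcm_proj1_if_dvd_nat lcm_proj2_if_dvd_nat le_imp_power_dvd max.absorb1 max.absorb2 nat_le_linear)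

text \<open>At primes outside \<open>P\<close> the exponent of \<open>u\<close>, hence that of the
  gcd, is zero. This turns the indicator \<open>g\<close> into a product of local
  indicators.\<close>

lemma gcd_dvd_iff_prime_powers:
  assumes "\<And>p. p \<in> P \<Longrightarrow> prime p" "prime_factors u \<subseteq> P" "u > 0" "v > 0" "n > (0::nat)"
  shows "gcd u v dvd n \<longleftrightarrow> (\<forall>p\<in>P. gcd (p ^ multiplicity p u) (p ^ multiplicity p v) dvd n)"
proof -
  have "gcd u v dvd n \<longleftrightarrow> (\<forall>p. prime p \<longrightarrow> min (multiplicity p u) (multiplicity p v) \<le> multiplicity p n)"
    using assms by (subst prime_multiplicity_le_imp_dvd) (auto simp: multiplicity_gcd)
  also have "\<dots> \<longleftrightarrow> (\<forall>p\<in>P. min (multiplicity p u) (multiplicity p v) \<le> multiplicity p n)"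
  proof (intro iffI ballI allI impI)
    fix p :: nat assume *: "\<forall>p\<in>P. min (multiplicity p u) (multiplicity p v) \<le> multiplicity p n" "prime p"
    show "min (multiplicity p u) (multiplicity p v) \<le> multiplicity p n"
    proof (cases "p \<in> P")
      case False
      hence "multiplicity p u = 0" using assms(2,3) *(2)
        by (auto simp: prime_factors_multiplicity)
      thus ?thesis by simp
    qed (use * in auto)
  qed (use assms(1) in auto)
  also have "\<dots> \<longleftrightarrow> (\<forall>p\<in>P. gcd (p ^ multiplicity p u) (p ^ multiplicity p v) dvd n)"
  proof (intro ball_cong refl)
    fix p assume "p \<in> P"
    hence "\<not> is_unit p" using assms(1) by (metis not_prime_unit)
    thus "min (multiplicity p u) (multiplicity p v) \<le> multiplicity p n \<longleftrightarrow>
        gcd (p ^ multiplicity p u) (p ^ multiplicity p v) dvd n"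
      using assms(5) by (subst gcd_prime_powers, subst power_dvd_iff_le_multiplicity) auto
  qed
  finally show ?thesis .
qed

lemma prod_indicator:
  "finite P \<Longrightarrow> (\<Prod>p\<in>P. if C p then 1 else 0 :: real) = (if \<forall>p\<in>P. C p then 1 else 0)"
  by (induction P rule: finite_induct) auto

lemma corr_multiplicative:
  assumes "finite P" "\<And>p. p \<in> P \<Longrightarrow> prime p" "prime_factors (prod3 t) \<subseteq> P" "t \<in> pos3" "h > 0"
  shows "corr h t = (\<Prod>p\<in>P. corr h (prime_pow3 p (mult3 p t)))"
proof -
  obtain u v w where t: "t = (u, v, w)" by (cases t)
  have pos: "u > 0" "v > 0" "w > 0" using assms(4) by (auto simp: pos3_def t)
  have P: "prime_factors u \<subseteq> P" "prime_factors v \<subseteq> P" "prime_factors w \<subseteq> P"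
    using assms(3,4) by (auto simp: t prod3_def pos3_def prime_factors_dvd subset_iff)
  let ?m = "\<lambda>n p. p ^ multiplicity p n"
  note dvd = gcd_dvd_iff_prime_powers[where P = P, OF assms(2)]
  have g: "g h u v w = (\<Prod>p\<in>P. g h (?m u p) (?m v p) (?m w p))"
    unfolding g_eq prod_indicator[OF assms(1)]
    using dvd[OF _ P(1) pos(1,2), of h] dvd[OF _ P(2) pos(2,3), of h]
      dvd[OF _ P(1) pos(1,3), of "2 * h"] assms(5) by auto
  have lcm_factors: "prime_factors (lcm3 u v w) \<subseteq> P"
    using P pos by (auto simp: prime_factors_lcm)
  have "multiplicity p (lcm3 u v w) = max (multiplicity p u) (max (multiplicity p v) (multiplicity p w))"
    if "p \<in> P" for p using assms(2)[OF that] pos by (simp add: multiplicity_lcm)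
  hence "lcm3 u v w = (\<Prod>p\<in>P. lcm3 (?m u p) (?m v p) (?m w p))"
    using prod_multiplicity[OF assms(1,2) lcm_factors] pos
    by (simp add: lcm_prime_powers lcm_pos_nat)
  hence lcm: "real (lcm3 u v w) = (\<Prod>p\<in>P. real (lcm3 (?m u p) (?m v p) (?m w p)))"
    by (metis of_nat_prod)
  have "u * v * w = (\<Prod>p\<in>P. ?m u p * ?m v p * ?m w p)"
    using prod_multiplicity[OF assms(1,2)] P pos by (simp add: prod.distrib)
  hence prod: "real (u * v * w) = (\<Prod>p\<in>P. real (?m u p * ?m v p * ?m w p))"
    by (metis of_nat_prod)
  show ?thesis
    by (simp add: t corr_def prime_pow3_def mult3_def g lcm prod prod.distrib prod_dividef
        del: of_nat_mult)
qed

text \<open>Applying "gcd times lcm equals product" twice, the quotient of u v w by the triple lcm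
  is \<open>gcd v w\<close> times \<open>gcd u (lcm v w)\<close>, and the latter divides
  \<open>gcd u v * gcd u w\<close>. In the solvable case the three gcds are at most h, h and 2
  h.\<close>

lemma corr_bound:
  assumes "u > 0" "v > 0" "w > 0" "h > 0"
  shows "0 \<le> corr h (u, v, w)" "corr h (u, v, w) \<le> 2 * real h ^ 3"
proof -
  show "0 \<le> corr h (u, v, w)" by (simp add: corr_def g_def)
  show "corr h (u, v, w) \<le> 2 * real h ^ 3"
  proof (cases "gcd u v dvd h \<and> gcd v w dvd h \<and> gcd u w dvd 2 * h")
    case True
    have "u * v * w = u * (gcd v w * lcm v w)" using prod_gcd_lcm_nat[of v w] by simp
    also have "\<dots> = gcd v w * (u * lcm v w)" by simp
    also have "u * lcm v w = gcd u (lcm v w) * lcm3 u v w" by (rule prod_gcd_lcm_nat)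
    also have "gcd v w * (gcd u (lcm v w) * lcm3 u v w) \<le> h * ((h * (2 * h)) * lcm3 u v w)"
    proof (intro mult_mono)
      show "gcd v w \<le> h" using True assms by (auto intro: dvd_imp_le)
      have "gcd u (lcm v w) = lcm (gcd u v) (gcd u w)" by (rule gcd_lcm_distrib)
      also have "\<dots> \<le> gcd u v * gcd u w"
        using assms by (intro dvd_imp_le) (auto simp: lcm_least)
      also have "\<dots> \<le> h * (2 * h)"
        using True assms by (intro mult_mono dvd_imp_le) auto
      finally show "gcd u (lcm v w) \<le> h * (2 * h)" .
    qed auto
    finally have "real (u * v * w) \<le> real (h * ((h * (2 * h)) * lcm3 u v w))"
      by (simp only: of_nat_le_iff)
    hence "real (u * v * w) / real (lcm3 u v w) \<le> 2 * real h ^ 3"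
      using assms by (subst pos_divide_le_eq) (auto simp: lcm_pos_nat power3_eq_cube mult_ac)
    thus ?thesis using True by (simp add: corr_def g_eq)
  qed (auto simp: corr_def g_eq)
qed

section \<open>Summatory functions of the divisor functions\<close>

definition upto_real :: "real \<Rightarrow> nat set" where
  "upto_real x = {n. 0 < n \<and> real n \<le> x}"

lemma upto_real_eq: "upto_real x = {1..nat \<lfloor>x\<rfloor>}"
  unfolding upto_real_def by (auto simp: le_nat_floor) linarith+

lemma finite_upto_real [simp]: "finite (upto_real x)"
  by (simp add: upto_real_eq)

lemma upto_real_empty: "x < 1 \<Longrightarrow> upto_real x = {}"
  by (auto simp: upto_real_def)

lemma sum_upto_divisors:
  fixes f :: "nat \<Rightarrow> nat \<Rightarrow> real"
  shows "(\<Sum>u\<in>upto_real x. \<Sum>d | d dvd u. f d (u div d)) =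
    (\<Sum>d\<in>upto_real x. \<Sum>n\<in>upto_real (x / real d). f d n)"
proof -
  have "(\<Sum>u\<in>upto_real x. \<Sum>d | d dvd u. f d (u div d)) =
    (\<Sum>(u, d)\<in>(SIGMA u:upto_real x. {d. d dvd u}). f d (u div d))"
    by (rule sum.Sigma) (auto simp: upto_real_eq)
  also have "\<dots> = (\<Sum>(d, n)\<in>(SIGMA d:upto_real x. upto_real (x / real d)). f d n)"
  proof (rule sum.reindex_bij_witness[of _ "\<lambda>(d, n). (d * n, d)" "\<lambda>(u, d). (d, u div d)"], goal_cases)
    case (2 a)
    obtain u d where a: "a = (u, d)" "d dvd u" "u > 0" "real u \<le> x"
      using 2 by (auto simp: upto_real_def)
    then obtain n where n: "u = d * n" by auto
    have "d > 0" "n > 0" using a(3) n by auto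
    have "real d * 1 \<le> real d * real n" using \<open>n > 0\<close> by (intro mult_left_mono) auto
    also have "\<dots> \<le> x" using a n by simp
    finally have "real d \<le> x" by simp
    moreover have "real n \<le> x / real d"
      using a n \<open>d > 0\<close> by (simp add: field_simps)
    ultimately show ?case using a n \<open>d > 0\<close> \<open>n > 0\<close> by (auto simp: upto_real_def)
  qed (auto simp: upto_real_def field_simps)
  also have "\<dots> = (\<Sum>d\<in>upto_real x. \<Sum>n\<in>upto_real (x / real d). f d n)"
    by (rule sum.Sigma[symmetric]) auto
  finally show ?thesis .
qed

text \<open>Mean value bounds without calculus: in the factorization of the difference each of the j
  + 1 terms lies between \<open>b ^ j\<close> and \<open>a ^ j\<close>.\<close>

lemma power_diff_bounds:
  fixes a b :: real
  assumes "0 \<le> b" "b \<le> a"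
  shows "real (Suc j) * b ^ j * (a - b) \<le> a ^ Suc j - b ^ Suc j"
    "a ^ Suc j - b ^ Suc j \<le> real (Suc j) * a ^ j * (a - b)"
proof -
  have eq: "a ^ Suc j - b ^ Suc j = (a - b) * (\<Sum>i<Suc j. a ^ i * b ^ (j - i))"
    by (subst power_diff_sumr2) (simp add: mult_ac)
  have "(\<Sum>i<Suc j. b ^ j) \<le> (\<Sum>i<Suc j. a ^ i * b ^ (j - i))"
  proof (rule sum_mono)
    fix i assume "i \<in> {..<Suc j}"
    hence "b ^ j = b ^ i * b ^ (j - i)" by (simp flip: power_add)
    also have "\<dots> \<le> a ^ i * b ^ (j - i)"
      using assms by (intro mult_right_mono power_mono) auto
    finally show "b ^ j \<le> a ^ i * b ^ (j - i)" .
  qed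
  hence "(a - b) * (\<Sum>i<Suc j. b ^ j) \<le> (a - b) * (\<Sum>i<Suc j. a ^ i * b ^ (j - i))"
    using assms by (intro mult_left_mono) auto
  thus "real (Suc j) * b ^ j * (a - b) \<le> a ^ Suc j - b ^ Suc j"
    unfolding eq by (simp add: mult_ac)
  have "(\<Sum>i<Suc j. a ^ i * b ^ (j - i)) \<le> (\<Sum>i<Suc j. a ^ j)"
  proof (rule sum_mono)
    fix i assume i: "i \<in> {..<Suc j}"
    have "a ^ i * b ^ (j - i) \<le> a ^ i * a ^ (j - i)"
      using assms by (intro mult_left_mono power_mono) auto
    also have "\<dots> = a ^ j" using i by (simp flip: power_add)
    finally show "a ^ i * b ^ (j - i) \<le> a ^ j" .
  qed
  hence "(a - b) * (\<Sum>i<Suc j. a ^ i * b ^ (j - i)) \<le> (a - b) * (\<Sum>i<Suc j. a ^ j)"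
    using assms by (intro mult_left_mono) auto
  thus "a ^ Suc j - b ^ Suc j \<le> real (Suc j) * a ^ j * (a - b)"
    unfolding eq by (simp add: mult_ac)
qed

lemma ln_Suc_diff_bounds:
  assumes "n > 0"
  shows "ln (real (Suc n)) - ln (real n) \<le> 1 / real n"
    "1 / real (Suc n) \<le> ln (real (Suc n)) - ln (real n)"
proof -
  have "ln (real (Suc n)) - ln (real n) = ln (1 + 1 / real n)"
  proof -
    have "ln (real (Suc n)) - ln (real n) = ln (real (Suc n) / real n)"
      using assms by (subst ln_div) auto
    thus ?thesis using assms by (simp add: add_divide_distrib add.commute)
  qed
  also have "\<dots> \<le> 1 / real n" by (rule ln_add_one_self_le_self) auto
  finally show "ln (real (Suc n)) - ln (real n) \<le> 1 / real n" .
  have "ln (real n) - ln (real (Suc n)) = ln (real n / real (Suc n))"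
    using assms by (subst ln_div) auto
  also have "\<dots> \<le> real n / real (Suc n) - 1"
    using assms by (intro ln_le_minus_one) auto
  also have "\<dots> = - (1 / real (Suc n))" by (simp add: field_simps)
  finally show "1 / real (Suc n) \<le> ln (real (Suc n)) - ln (real n)" by simp
qed

text \<open>Integral comparison by telescoping. With \<open>a n\<close> = ln (x / n), the decrease
  of \<open>a n ^ Suc j\<close> from n to n + 1 lies between j + 1 times the summand at n + 1 and j
  + 1 times the summand at n. The errors come only from the two ends: the first summand, and the
  leftover \<open>a N ^ Suc j / real (Suc j)\<close> at the last index.\<close>

lemma sum_ln_power_bound:
  assumes "x \<ge> (1::real)"
  shows "\<bar>(\<Sum>n\<in>upto_real x. ln (x / real n) ^ j / real n) - ln x ^ Suc j / real (Suc j)\<bar> \<le> (1 + ln x) ^ j"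
proof -
  define N where "N = nat \<lfloor>x\<rfloor>"
  have N: "N \<ge> 1" "real N \<le> x" "x < real N + 1"
    using assms unfolding N_def by linarith+
  define a where "a n = ln (x / real n)" for n
  have a_eq: "a n = ln x - ln (real n)" if "n > 0" for n
    using that assms by (simp add: a_def ln_div)
  have a_nonneg: "a n \<ge> 0" if "n \<in> {1..N}" for n
    using that N by (auto simp: a_def)
  have a_mono: "a (Suc n) \<le> a n" if "n > 0" for n
    using that by (simp add: a_eq)
  have sum_eq: "(\<Sum>n\<in>upto_real x. ln (x / real n) ^ j / real n) = (\<Sum>n=1..N. a n ^ j / real n)"
    by (simp add: upto_real_eq N_def a_def)
  have tele: "(\<Sum>n=1..<N. a n ^ Suc j - a (Suc n) ^ Suc j) = ln x ^ Suc j - a N ^ Suc j"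
    using sum_Suc_diff'[of 1 N "\<lambda>n. - (a n ^ Suc j)"] N(1) by (simp add: a_def)
  have lnx: "ln x \<ge> 0" using assms by simp
  have split_last: "{1..N} = insert N {1..<N}" and split_first: "{1..N} = insert 1 (Suc ` {1..<N})"
    using N(1) by (auto simp: image_Suc_atLeastLessThan)
  have aN: "0 \<le> a N" "a N \<le> 1"
  proof -
    show "0 \<le> a N" using a_nonneg N by auto
    \<comment> \<open>Here x < N + 1 \<le> 2 N.\<close>
    have "a N \<le> x / real N - 1" unfolding a_def using N by (intro ln_le_minus_one) auto
    also have "\<dots> \<le> 1" using N by (simp add: field_simps)
    finally show "a N \<le> 1" .
  qed
  have "(ln x ^ Suc j - a N ^ Suc j) \<le> (\<Sum>n=1..<N. real (Suc j) * (a n ^ j / real n))"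
    unfolding tele[symmetric]
  proof (rule sum_mono)
    fix n assume n: "n \<in> {1..<N}"
    have "a n ^ Suc j - a (Suc n) ^ Suc j \<le> real (Suc j) * a n ^ j * (a n - a (Suc n))"
      using n a_nonneg[of "Suc n"] a_mono[of n] by (intro power_diff_bounds) auto
    also have "\<dots> \<le> real (Suc j) * a n ^ j * (1 / real n)"
      using n a_nonneg[of n] ln_Suc_diff_bounds(1)[of n] by (intro mult_left_mono) (auto simp: a_eq)
    finally show "a n ^ Suc j - a (Suc n) ^ Suc j \<le> real (Suc j) * (a n ^ j / real n)" by simp
  qed
  also have "\<dots> \<le> real (Suc j) * (\<Sum>n=1..N. a n ^ j / real n)"
    unfolding sum_distrib_left[symmetric]
    using a_nonneg by (intro mult_left_mono sum_mono2) auto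
  finally have lower: "(ln x ^ Suc j - a N ^ Suc j) / real (Suc j) \<le> (\<Sum>n=1..N. a n ^ j / real n)"
    by (subst pos_divide_le_eq) (auto simp: mult_ac)
  have "real (Suc j) * (\<Sum>n=1..<N. a (Suc n) ^ j / real (Suc n)) \<le> (ln x ^ Suc j - a N ^ Suc j)"
    unfolding tele[symmetric] sum_distrib_left
  proof (rule sum_mono)
    fix n assume n: "n \<in> {1..<N}"
    have "real (Suc j) * (a (Suc n) ^ j / real (Suc n)) = real (Suc j) * a (Suc n) ^ j * (1 / real (Suc n))"
      by simp
    also have "\<dots> \<le> real (Suc j) * a (Suc n) ^ j * (a n - a (Suc n))"
      using n a_nonneg[of "Suc n"] ln_Suc_diff_bounds(2)[of n] by (intro mult_left_mono) (auto simp: a_eq)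
    also have "\<dots> \<le> a n ^ Suc j - a (Suc n) ^ Suc j"
      using n a_nonneg[of "Suc n"] a_mono[of n] by (intro power_diff_bounds) auto
    finally show "real (Suc j) * (a (Suc n) ^ j / real (Suc n)) \<le> a n ^ Suc j - a (Suc n) ^ Suc j" .
  qed
  moreover have "(\<Sum>n=1..N. a n ^ j / real n) = a 1 ^ j + (\<Sum>n=1..<N. a (Suc n) ^ j / real (Suc n))"
  proof -
    have "(\<Sum>n=1..N. a n ^ j / real n) = a 1 ^ j / real 1 + (\<Sum>n\<in>Suc ` {1..<N}. a n ^ j / real n)"
      unfolding split_first by (rule sum.insert) auto
    also have "(\<Sum>n\<in>Suc ` {1..<N}. a n ^ j / real n) = (\<Sum>n=1..<N. a (Suc n) ^ j / real (Suc n))"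
      by (subst sum.reindex) simp_all
    finally show ?thesis by simp
  qed
  ultimately have upper: "(\<Sum>n=1..N. a n ^ j / real n) \<le> a 1 ^ j + (ln x ^ Suc j - a N ^ Suc j) / real (Suc j)"
    by (simp add: field_simps)
  have p1: "a 1 ^ j \<le> (1 + ln x) ^ j" unfolding a_def using lnx by (intro power_mono) auto
  have p2: "0 \<le> a N ^ Suc j / real (Suc j)" using aN by (intro divide_nonneg_pos zero_le_power) auto
  have "a N ^ Suc j / real (Suc j) \<le> 1 / 1"
    using aN by (intro frac_le power_le_one) auto
  also have "1 / 1 \<le> (1 + ln x) ^ j" using lnx by simp
  finally have p3: "a N ^ Suc j / real (Suc j) \<le> (1 + ln x) ^ j" .
  show ?thesis unfolding sum_eq using lower upper p1 p2 p3
    unfolding diff_divide_distrib by linarith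
qed

definition divisor_sum :: "nat \<Rightarrow> real \<Rightarrow> real" where
  "divisor_sum k x = (\<Sum>n\<in>upto_real x. real (divisor_fun k n) / real n)"

lemma divisor_sum_Suc:
  "divisor_sum (Suc k) x = (\<Sum>n\<in>upto_real x. divisor_sum k (x / real n) / real n)"
proof -
  have "divisor_sum (Suc k) x = (\<Sum>u\<in>upto_real x. \<Sum>d | d dvd u. (real (divisor_fun k (u div d)) / real (u div d)) / real d)"
    unfolding divisor_sum_def
  proof (rule sum.cong[OF refl])
    fix u assume "u \<in> upto_real x"
    hence u: "u > 0" by (simp add: upto_real_def)
    have "real (divisor_fun (Suc k) u) / real u = (\<Sum>d | d dvd u. real (divisor_fun k d) / real u)"
      using u by (simp add: divisor_fun_Suc sum_divide_distrib)
    \<comment> \<open>Passing to complementary divisors puts the divisor function on the inner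
      variable, where it sums to \<open>divisor_sum k\<close> at \<open>x / real d\<close>.\<close>
    also have "\<dots> = (\<Sum>d | d dvd u. real (divisor_fun k (u div d)) / real u)"
      using u by (intro sum.reindex_bij_witness[of _ "\<lambda>d. u div d" "\<lambda>d. u div d"]) auto
    also have "\<dots> = (\<Sum>d | d dvd u. (real (divisor_fun k (u div d)) / real (u div d)) / real d)"
      using u by (intro sum.cong refl) (auto simp: real_of_nat_div)
    finally show "real (divisor_fun (Suc k) u) / real u =
      (\<Sum>d | d dvd u. (real (divisor_fun k (u div d)) / real (u div d)) / real d)" .
  qed
  also have "\<dots> = (\<Sum>d\<in>upto_real x. \<Sum>n\<in>upto_real (x / real d). (real (divisor_fun k n) / real n) / real d)"
    by (rule sum_upto_divisors)
  finally show ?thesis by (simp add: divisor_sum_def sum_divide_distrib)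
qed

lemma divisor_sum_0: "x \<ge> 1 \<Longrightarrow> divisor_sum 0 x = 1"
proof -
  assume x: "x \<ge> 1"
  have "divisor_sum 0 x = (\<Sum>n\<in>{1}. real (divisor_fun 0 n) / real n)"
    unfolding divisor_sum_def using x
    by (intro sum.mono_neutral_right finite_upto_real) (auto simp: divisor_fun_0 upto_real_def)
  thus ?thesis by (simp add: divisor_fun_0)
qed

text \<open>One convolution with 1 costs two errors of the same order: the old error summed against
  1 / n, which gains a harmonic sum of size at most 1 + ln x, and the error in summing the old main
  term. The second has constant 1, so the constant grows by 1 at each step.\<close>

lemma divisor_sum_asymp:
  "\<exists>C\<ge>0. \<forall>x\<ge>1. \<bar>divisor_sum (Suc j) x - ln x ^ Suc j / fact (Suc j)\<bar> \<le> C * (1 + ln x) ^ j"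
proof (induction j)
  case 0
  have "\<bar>divisor_sum (Suc 0) x - ln x ^ Suc 0 / fact (Suc 0)\<bar> \<le> 1 * (1 + ln x) ^ 0" if x: "x \<ge> 1" for x
  proof -
    have "divisor_sum (Suc 0) x = (\<Sum>n\<in>upto_real x. ln (x / real n) ^ 0 / real n)"
      unfolding divisor_sum_Suc
      by (intro sum.cong refl) (subst divisor_sum_0, auto simp: upto_real_def)
    thus ?thesis using sum_ln_power_bound[OF x, of 0] by simp
  qed
  thus ?case by (intro exI[of _ 1]) auto
next
  case (Suc j)
  then obtain C where C: "C \<ge> 0"
    "\<And>x. x \<ge> 1 \<Longrightarrow> \<bar>divisor_sum (Suc j) x - ln x ^ Suc j / fact (Suc j)\<bar> \<le> C * (1 + ln x) ^ j"
    by blast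
  have "\<bar>divisor_sum (Suc (Suc j)) x - ln x ^ Suc (Suc j) / fact (Suc (Suc j))\<bar> \<le>
    (C + 1) * (1 + ln x) ^ Suc j" if x: "x \<ge> 1" for x
  proof -
    have lnx: "ln x \<ge> 0" using x by simp
    let ?h = "\<Sum>n\<in>upto_real x. 1 / real n"
    let ?S = "\<Sum>n\<in>upto_real x. ln (x / real n) ^ Suc j / real n"
    have h: "?h \<le> 1 + ln x" using sum_ln_power_bound[OF x, of 0] by simp
    have "\<bar>divisor_sum (Suc (Suc j)) x - ?S / fact (Suc j)\<bar> =
       \<bar>\<Sum>n\<in>upto_real x. (divisor_sum (Suc j) (x / real n) - ln (x / real n) ^ Suc j / fact (Suc j)) / real n\<bar>"
      unfolding divisor_sum_Suc[of "Suc j"] sum_divide_distrib sum_subtractf[symmetric]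
      by (intro arg_cong[of _ _ abs] sum.cong refl) (simp add: diff_divide_distrib)
    also have "\<dots> \<le> (\<Sum>n\<in>upto_real x. C * (1 + ln x) ^ j * (1 / real n))"
    proof (rule order.trans[OF sum_abs sum_mono])
      fix n assume "n \<in> upto_real x"
      hence n: "n > 0" "real n \<le> x" by (auto simp: upto_real_def)
      hence xn: "x / real n \<ge> 1" by simp
      have "x / real n \<le> x / 1" using n x by (intro divide_left_mono) auto
      hence le: "ln (x / real n) \<le> ln x" using xn x by (subst ln_le_cancel_iff) auto
      have "\<bar>divisor_sum (Suc j) (x / real n) - ln (x / real n) ^ Suc j / fact (Suc j)\<bar> \<le>
        C * (1 + ln (x / real n)) ^ j" by (rule C(2)[OF xn])
      also have "\<dots> \<le> C * (1 + ln x) ^ j"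
        using le xn C(1) by (intro mult_left_mono power_mono) auto
      finally show "\<bar>(divisor_sum (Suc j) (x / real n) - ln (x / real n) ^ Suc j / fact (Suc j)) / real n\<bar>
        \<le> C * (1 + ln x) ^ j * (1 / real n)"
        using n by (simp add: abs_mult divide_right_mono)
    qed
    also have "\<dots> = C * (1 + ln x) ^ j * ?h" by (simp add: sum_distrib_left)
    also have "\<dots> \<le> C * (1 + ln x) ^ j * (1 + ln x)"
      using h C(1) lnx by (intro mult_left_mono) auto
    finally have 1: "\<bar>divisor_sum (Suc (Suc j)) x - ?S / fact (Suc j)\<bar> \<le> C * (1 + ln x) ^ Suc j"
      by (simp add: mult_ac)
    have "\<bar>?S / fact (Suc j) - ln x ^ Suc (Suc j) / fact (Suc (Suc j))\<bar> =
      \<bar>?S - ln x ^ Suc (Suc j) / real (Suc (Suc j))\<bar> / fact (Suc j)"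
    proof -
      have "?S / fact (Suc j) - ln x ^ Suc (Suc j) / fact (Suc (Suc j)) =
        (?S - ln x ^ Suc (Suc j) / real (Suc (Suc j))) / fact (Suc j)"
        unfolding fact_Suc[of "Suc j"] by (simp only: diff_divide_distrib divide_divide_eq_left)
      thus ?thesis by (simp only: abs_divide abs_of_pos[OF fact_gt_zero])
    qed
    also have "\<dots> \<le> (1 + ln x) ^ Suc j / 1"
      using sum_ln_power_bound[OF x, of "Suc j"] lnx fact_ge_1[of "Suc j"]
      by (intro frac_le) (auto simp del: fact_Suc)
    finally have 2: "\<bar>?S / fact (Suc j) - ln x ^ Suc (Suc j) / fact (Suc (Suc j))\<bar> \<le> (1 + ln x) ^ Suc j"
      by simp
    have "\<bar>divisor_sum (Suc (Suc j)) x - ln x ^ Suc (Suc j) / fact (Suc (Suc j))\<bar> \<le>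
      C * (1 + ln x) ^ Suc j + (1 + ln x) ^ Suc j"
      using 1 2 by linarith
    thus ?thesis by (simp add: algebra_simps)
  qed
  thus ?case using C(1) by (intro exI[of _ "C + 1"]) auto
qed

text \<open>This includes \<open>a > x\<close>, where the sum is empty and \<open>ln x < ln a\<close>.\<close>

lemma divisor_sum_shift:
  "\<exists>C\<ge>0. \<forall>x\<ge>1. \<forall>a\<ge>1.
     \<bar>divisor_sum (Suc j) (x / a) - ln x ^ Suc j / fact (Suc j)\<bar> \<le> C * (1 + ln x) ^ j * (1 + ln a)"
proof -
  obtain C where C: "C \<ge> 0"
    "\<And>x. x \<ge> 1 \<Longrightarrow> \<bar>divisor_sum (Suc j) x - ln x ^ Suc j / fact (Suc j)\<bar> \<le> C * (1 + ln x) ^ j"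
    using divisor_sum_asymp[of j] by blast
  have "\<bar>divisor_sum (Suc j) (x / a) - ln x ^ Suc j / fact (Suc j)\<bar> \<le> (C + 1) * (1 + ln x) ^ j * (1 + ln a)"
    if x: "x \<ge> 1" and a: "a \<ge> 1" for x a :: real
  proof -
    have l: "ln x \<ge> 0" "ln a \<ge> 0" using x a by auto
    have pw: "(1 + ln x) ^ j \<ge> 0" "(1 + ln x) ^ j * ln a \<ge> 0" using l by auto
    have fact: "(1::real) \<le> fact (Suc j)" by (rule fact_ge_1)
    have fpos: "fact (Suc j) > (0::real)" by simp
    show ?thesis
    proof (cases "a \<le> x")
      case True
      let ?y = "x / a"
      have y: "?y \<ge> 1" using True a by simp
      have "?y \<le> x / 1" using a x by (intro divide_left_mono) auto
      hence le: "ln ?y \<le> ln x" using y x by (subst ln_le_cancel_iff) auto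
      have eq: "ln x - ln ?y = ln a" using x a by (simp add: ln_div)
      have y0: "ln ?y \<ge> 0" using y by simp
      have "\<bar>divisor_sum (Suc j) ?y - ln ?y ^ Suc j / fact (Suc j)\<bar> \<le> C * (1 + ln ?y) ^ j"
        by (rule C(2)[OF y])
      also have "\<dots> \<le> C * (1 + ln x) ^ j"
        using le y0 C(1) by (intro mult_left_mono power_mono) auto
      finally have 1: "\<bar>divisor_sum (Suc j) ?y - ln ?y ^ Suc j / fact (Suc j)\<bar> \<le> C * (1 + ln x) ^ j" .
      have "ln x ^ Suc j - ln ?y ^ Suc j \<le> real (Suc j) * ln x ^ j * (ln x - ln ?y)"
        using le y0 by (intro power_diff_bounds)
      also have "\<dots> \<le> fact (Suc j) * (1 + ln x) ^ j * ln a"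
      proof -
        have "real (Suc j) \<le> fact (Suc j)"
          using fact_ge_self[of "Suc j"] by (metis of_nat_fact of_nat_le_iff)
        moreover have "ln x ^ j \<le> (1 + ln x) ^ j" using l by (intro power_mono) auto
        ultimately have "real (Suc j) * ln x ^ j \<le> fact (Suc j) * (1 + ln x) ^ j"
          by (rule mult_mono) (use l fpos in auto)
        thus ?thesis unfolding eq using l by (intro mult_right_mono)
      qed
      finally have "(ln x ^ Suc j - ln ?y ^ Suc j) / fact (Suc j) \<le> (1 + ln x) ^ j * ln a"
        by (subst pos_divide_le_eq[OF fpos]) (simp add: mult_ac del: fact_Suc)
      moreover have "(ln x ^ Suc j - ln ?y ^ Suc j) / fact (Suc j) \<ge> 0"
        using le y0 by (intro divide_nonneg_pos) (auto simp del: power_Suc fact_Suc intro!: power_mono)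
      ultimately have "\<bar>divisor_sum (Suc j) ?y - ln x ^ Suc j / fact (Suc j)\<bar> \<le>
        C * (1 + ln x) ^ j + (1 + ln x) ^ j * ln a"
        using 1 unfolding diff_divide_distrib by linarith
      also have "\<dots> \<le> (C + 1) * (1 + ln x) ^ j * (1 + ln a)"
        using C(1) pw by (simp add: algebra_simps mult_nonneg_nonneg)
      finally show ?thesis .
    next
      case False
      hence "x / a < 1" using a by simp
      hence 0: "divisor_sum (Suc j) (x / a) = 0" by (simp add: divisor_sum_def upto_real_empty)
      have "ln x ^ Suc j / fact (Suc j) \<le> ln x ^ Suc j / 1"
        using l fact by (intro divide_left_mono) auto
      also have "\<dots> \<le> (1 + ln x) ^ j * ln a"
      proof -
        have "ln x \<le> ln a" using False x a by simp
        hence "ln x ^ j * ln x \<le> (1 + ln x) ^ j * ln a"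
          using l by (intro mult_mono power_mono) auto
        thus ?thesis by (simp add: mult_ac)
      qed
      also have "\<dots> \<le> (C + 1) * (1 + ln x) ^ j * (1 + ln a)"
        using C(1) pw by (simp add: algebra_simps mult_nonneg_nonneg)
      finally show ?thesis using 0 l by simp
    qed
  qed
  thus ?thesis using C(1) by (intro exI[of _ "C + 1"]) auto
qed

section \<open>Local factors\<close>

text \<open>The parameters stand for k - 1, l - 1 and m - 1, the indices of the divisor functions in
  the sum.\<close>

locale lcm_sum =
  fixes h K L M :: nat
  assumes h_pos: "h > 0"
begin

text \<open>The formal variables stand for the powers of \<open>p\<close> dividing \<open>u\<close>, \<open>v\<close> and \<open>w\<close>; the weights
  \<open>1 / p ^ a\<close> are part of the coefficients.\<close>

definition div_series :: "nat \<Rightarrow> real fps fps fps" where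
  "div_series p = pow3 K L M (geo (1 / real p))"

definition div_series_inv :: "nat \<Rightarrow> real fps fps fps" where
  "div_series_inv p = pow3 K L M (geo_inv (1 / real p))"

definition local_series :: "nat \<Rightarrow> real fps fps fps" where
  "local_series p = Abs_fps (\<lambda>a. Abs_fps (\<lambda>b. Abs_fps (\<lambda>c.
     coeff3 (div_series p) (a, b, c) * corr h (prime_pow3 p (a, b, c)))))"

text \<open>The Euler factor of the function called \<open>b\<close> in the overview. Division by
  \<open>div_series p\<close> is multiplication by a polynomial.\<close>

definition quot_series :: "nat \<Rightarrow> real fps fps fps" where
  "quot_series p = local_series p * div_series_inv p"

lemma div_series_inv: "div_series p * div_series_inv p = 1"
  by (simp add: div_series_def div_series_inv_def pow3_mult geo_mult_inv)

lemma quot_series_mult: "quot_series p * div_series p = local_series p"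
  using div_series_inv[of p] by (simp add: quot_series_def mult_ac)

lemma coeff3_local_series:
  "coeff3 (local_series p) e = coeff3 (div_series p) e * corr h (prime_pow3 p e)"
  by (cases e) (simp add: coeff3_def local_series_def)

lemma coeff3_div_series:
  assumes "prime p"
  shows "coeff3 (div_series p) (a, b, c) = real (divisor_fun K (p ^ a)) / real (p ^ a) *
    (real (divisor_fun L (p ^ b)) / real (p ^ b)) * (real (divisor_fun M (p ^ c)) / real (p ^ c))"
  unfolding divisor_fun_prime_power[OF assms] div_series_def pow3_def coeff3_var_mult ..

text \<open>When two of the three numbers are 1, all gcds are 1 and the lcm is the product.\<close>

lemma corr_axis:
  assumes "p > 0" "size3 e \<le> 1"
  shows "corr h (prime_pow3 p e) = 1"
proof -
  obtain a b c where e: "e = (a, b, c)" by (cases e)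
  have "(a = 0 \<and> b = 0) \<or> (a = 0 \<and> c = 0) \<or> (b = 0 \<and> c = 0)" using assms(2) by (auto simp: e)
  thus ?thesis using assms(1) by (auto simp: e corr_def prime_pow3_def g_eq)
qed

text \<open>This form exposes a factor \<open>local_series p - div_series p\<close> without terms of
  size at most 1, a property that multiplication by any series preserves.\<close>

lemma quot_series_eq:
  "quot_series p = 1 + (local_series p - div_series p) * div_series_inv p"
  using div_series_inv[of p] by (simp add: quot_series_def algebra_simps)

lemma coeff3_quot_series_small:
  assumes "p > 0" "size3 e \<le> 1"
  shows "coeff3 (quot_series p) e = (if e = 0 then 1 else 0)"
proof -
  have "coeff3 ((local_series p - div_series p) * div_series_inv p) e = 0"
    unfolding coeff3_mult
  proof (rule sum.neutral, rule ballI)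
    fix d assume "d \<in> {..e}"
    hence "size3 d \<le> 1" using size3_mono[of d e] assms(2) by simp
    thus "coeff3 (local_series p - div_series p) d * coeff3 (div_series_inv p) (e - d) = 0"
      using corr_axis[OF assms(1)] by (simp add: coeff3_diff coeff3_local_series)
  qed
  thus ?thesis by (simp add: quot_series_eq coeff3_add coeff3_1)
qed

text \<open>The series \<open>geo (1 / real p)\<close> converges at radii below p, and a fixed
  proportion of p makes its norm independent of p. The proportion 3/4 gives norm 4, and 7/4 for the
  inverse; at p = 2 it still leaves the radius above 1, where evaluation takes place, and above
  p^(1/4).\<close>

definition radius :: "nat \<Rightarrow> real" where "radius p = 3 / 4 * real p"

lemma radius_ge_1: "prime p \<Longrightarrow> radius p \<ge> 1"
  using prime_ge_2_nat[of p] by (simp add: radius_def)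

lemma div_series_norm:
  assumes "prime p"
  shows "abs3 (radius p) (div_series p)" "norm3 (radius p) (div_series p) \<le> 4 ^ (K + L + M)"
proof -
  have "((\<lambda>n. \<bar>fps_nth (geo (1 / real p)) n\<bar> * radius p ^ n) has_sum 4) UNIV"
    using has_sum_geo[of "1 / real p" "radius p"] prime_gt_0_nat[OF assms] by (simp add: radius_def)
  from abs3_pow3[OF this, of K L M] show "abs3 (radius p) (div_series p)"
    "norm3 (radius p) (div_series p) \<le> 4 ^ (K + L + M)"
    by (simp_all add: div_series_def radius_def)
qed

lemma has_sum_div_series_inv:
  assumes "prime p"
  shows "((\<lambda>n. \<bar>fps_nth (geo_inv (1 / real p)) n\<bar> * radius p ^ n) has_sum (7 / 4)) UNIV"
  using has_sum_geo_inv[of "1 / real p" "radius p"] prime_gt_0_nat[OF assms] by (simp add: radius_def)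

lemma div_series_inv_norm:
  assumes "prime p"
  shows "abs3 (radius p) (div_series_inv p)"
    "norm3 (radius p) (div_series_inv p) \<le> (7 / 4) ^ (K + L + M)"
  using abs3_pow3[OF has_sum_div_series_inv[OF assms], of K L M]
  by (simp_all add: div_series_inv_def radius_def)

text \<open>The source of the convergence factors (1 - 1/p)^(k + l + m - 3) in
  \<open>nabla\<close>.\<close>

lemma eval3_div_series_inv:
  assumes "prime p"
  shows "eval3 (div_series_inv p) = (1 - 1 / real p) ^ (K + L + M)"
  unfolding div_series_inv_def
  using eval3_pow3[OF has_sum_div_series_inv[OF assms] has_sum_geo_inv' radius_ge_1[OF assms]] .

text \<open>By \<open>corr_bound\<close> the coefficients are dominated by those of
  \<open>div_series p\<close>, with a constant that depends on \<open>h\<close> but not on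
  \<open>p\<close>.\<close>

lemma local_series_norm:
  assumes "prime p"
  shows "abs3 (radius p) (local_series p)"
    "norm3 (radius p) (local_series p) \<le> 2 * real h ^ 3 * 4 ^ (K + L + M)"
proof -
  have r: "radius p \<ge> 0" by (simp add: radius_def)
  have le: "\<bar>coeff3 (local_series p) e\<bar> * radius p ^ size3 e \<le>
    2 * real h ^ 3 * (\<bar>coeff3 (div_series p) e\<bar> * radius p ^ size3 e)" for e
  proof -
    obtain a b c where e: "e = (a, b, c)" by (cases e)
    have "0 \<le> corr h (prime_pow3 p e)" "corr h (prime_pow3 p e) \<le> 2 * real h ^ 3"
      unfolding e prime_pow3_def case_prod_conv
      using prime_gt_0_nat[OF assms] h_pos by (intro corr_bound; simp)+
    hence "\<bar>coeff3 (local_series p) e\<bar> \<le> 2 * real h ^ 3 * \<bar>coeff3 (div_series p) e\<bar>"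
      unfolding coeff3_local_series abs_mult by (subst mult.commute, intro mult_right_mono) auto
    from mult_right_mono[OF this, of "radius p ^ size3 e"] r show ?thesis by (simp add: mult_ac)
  qed
  have sum: "((\<lambda>e. 2 * real h ^ 3 * (\<bar>coeff3 (div_series p) e\<bar> * radius p ^ size3 e)) has_sum
    (2 * real h ^ 3 * norm3 (radius p) (div_series p))) UNIV"
    by (intro has_sum_cmult_right abs3_has_sum div_series_norm assms)
  have "(\<lambda>e. norm (\<bar>coeff3 (local_series p) e\<bar> * radius p ^ size3 e)) summable_on UNIV"
    by (rule Infinite_Sum.abs_summable_on_comparison_test'[OF has_sum_imp_summable[OF sum]])
       (use le r in auto)
  thus abs: "abs3 (radius p) (local_series p)" unfolding abs3_def by (rule abs_summable_summable)
  have "norm3 (radius p) (local_series p) \<le> 2 * real h ^ 3 * norm3 (radius p) (div_series p)"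
    using abs3_has_sum[OF abs] sum by (rule has_sum_mono) (use le in auto)
  also have "\<dots> \<le> 2 * real h ^ 3 * 4 ^ (K + L + M)"
    by (intro mult_left_mono div_series_norm assms) auto
  finally show "norm3 (radius p) (local_series p) \<le> 2 * real h ^ 3 * 4 ^ (K + L + M)" .
qed

definition quot_bound :: real where
  "quot_bound = 2 * real h ^ 3 * 4 ^ (K + L + M) * (7 / 4) ^ (K + L + M)"

lemma quot_bound_nonneg: "quot_bound \<ge> 0"
  by (simp add: quot_bound_def)

lemma quot_series_norm:
  assumes "prime p"
  shows "abs3 (radius p) (quot_series p)" "norm3 (radius p) (quot_series p) \<le> quot_bound"
proof -
  have r: "radius p \<ge> 0" by (simp add: radius_def)
  show "abs3 (radius p) (quot_series p)" unfolding quot_series_def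
    by (intro abs3_norm3_mult local_series_norm div_series_inv_norm assms r)
  have "norm3 (radius p) (quot_series p) \<le>
      norm3 (radius p) (local_series p) * norm3 (radius p) (div_series_inv p)"
    unfolding quot_series_def
    by (intro abs3_norm3_mult local_series_norm div_series_inv_norm assms r)
  also have "\<dots> \<le> quot_bound" unfolding quot_bound_def
    by (intro mult_mono local_series_norm div_series_inv_norm assms norm3_nonneg r) auto
  finally show "norm3 (radius p) (quot_series p) \<le> quot_bound" .
qed

text \<open>As the coefficients of size \<open>1\<close> vanish, passing from the radius \<open>3 p / 4\<close> to \<open>p\<^sup>1\<^sup>/\<^sup>4\<close> gains
  the square of the ratio of the radii.\<close>

lemma quot_series_weight:
  assumes "prime p" "finite E" "0 \<notin> E"
  shows "(\<Sum>e\<in>E. \<bar>coeff3 (quot_series p) e\<bar> * (real p powr (1/4)) ^ size3 e) \<le>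
    2 * quot_bound * real p powr (-3/2)"
proof -
  define q where "q = real p powr (1/4)"
  have p: "p \<ge> 2" using assms(1) by (rule prime_ge_2_nat)
  have q: "q > 0" using p by (simp add: q_def)
  have q4: "q ^ 4 = real p" unfolding q_def using p by (simp flip: powr_realpow add: powr_powr)
  have q6: "1 / q ^ 6 = real p powr (-3/2)" unfolding q_def using p
    by (simp flip: powr_realpow add: powr_powr powr_minus_divide)
  have r: "radius p = 3/4 * q ^ 4" by (simp add: radius_def q4)
  \<comment> \<open>A rational number with fourth power below 2 and cube at least 4/3. The cube
    condition is what q \<le> 3/4 q^4, the radius, amounts to.\<close>
  have "q \<ge> 115/100"
  proof (rule ccontr)
    assume "\<not> q \<ge> 115/100"
    hence "q ^ 4 \<le> (115/100) ^ 4" using q by (intro power_mono) auto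
    also have "\<dots> < 2" by (simp add: power4_eq_xxxx)
    finally show False using p unfolding q4 by simp
  qed
  hence "(115/100) ^ 3 \<le> q ^ 3" by (intro power_mono) auto
  moreover have "(4/3 :: real) \<le> (115/100) ^ 3" by (simp add: power3_eq_cube)
  ultimately have "4/3 \<le> q ^ 3" by linarith
  hence "q * (4/3) \<le> q * q ^ 3" using q by (intro mult_left_mono) auto
  hence qr: "q \<le> radius p" unfolding r by (simp add: power4_eq_xxxx power3_eq_cube)
  have rpos: "radius p > 0" using p by (simp add: radius_def)
  have le: "\<bar>coeff3 (quot_series p) e\<bar> * q ^ size3 e \<le>
    (q / radius p)\<^sup>2 * (\<bar>coeff3 (quot_series p) e\<bar> * radius p ^ size3 e)" if "e \<in> E" for e
  proof (cases "size3 e \<le> 1")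
    case True
    hence "coeff3 (quot_series p) e = 0"
      using coeff3_quot_series_small[of p e] p that assms(3) by auto
    thus ?thesis by simp
  next
    case False
    have "q ^ size3 e = (q / radius p) ^ size3 e * radius p ^ size3 e"
      using rpos by (simp add: power_divide)
    also have "\<dots> \<le> (q / radius p)\<^sup>2 * radius p ^ size3 e"
      using False q qr rpos by (intro mult_right_mono power_decreasing) auto
    finally have "\<bar>coeff3 (quot_series p) e\<bar> * q ^ size3 e \<le>
      \<bar>coeff3 (quot_series p) e\<bar> * ((q / radius p)\<^sup>2 * radius p ^ size3 e)"
      by (rule mult_left_mono) auto
    thus ?thesis by (simp add: mult_ac)
  qed
  have "(\<Sum>e\<in>E. \<bar>coeff3 (quot_series p) e\<bar> * q ^ size3 e) \<le>
    (q / radius p)\<^sup>2 * (\<Sum>e\<in>E. \<bar>coeff3 (quot_series p) e\<bar> * radius p ^ size3 e)"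
    unfolding sum_distrib_left by (intro sum_mono le)
  also have "\<dots> \<le> (q / radius p)\<^sup>2 * norm3 (radius p) (quot_series p)"
    unfolding norm3_def using quot_series_norm(1)[OF assms(1)] assms(2) rpos
    by (intro mult_left_mono finite_sum_le_infsum) (auto simp: abs3_def)
  also have "\<dots> \<le> (q / radius p)\<^sup>2 * quot_bound"
    by (intro mult_left_mono quot_series_norm[OF assms(1)]) auto
  \<comment> \<open>The radius is 3/4 q^4; the factor 16/9 is then rounded up to 2.\<close>
  also have "(q / radius p)\<^sup>2 = 16/9 * (1 / q ^ 6)"
    unfolding r using q by (simp add: field_simps power2_eq_square eval_nat_numeral)
  also have "16/9 * (1 / q ^ 6) * quot_bound \<le> 2 * (1 / q ^ 6) * quot_bound"
    using quot_bound_nonneg q by (intro mult_right_mono) auto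
  finally show ?thesis unfolding q6 q_def[symmetric] by (simp add: mult_ac)
qed

lemma quot_series_eval:
  assumes "prime p"
  shows "(coeff3 (quot_series p) has_sum eval3 (quot_series p)) UNIV"
  using abs3_eval[OF quot_series_norm(1) radius_ge_1] assms by blast

lemma eval3_quot_series:
  assumes "prime p"
  shows "eval3 (quot_series p) = (1 - 1 / real p) ^ (K + L + M) * eval3 (local_series p)"
  unfolding quot_series_def eval3_div_series_inv[OF assms, symmetric]
  using eval3_mult[OF local_series_norm(1) div_series_inv_norm(1) radius_ge_1] assms
  by (simp add: mult.commute)

lemma local_factor_dvd_eq:
  assumes "prime p"
  shows "local_factor_dvd h (Suc K) (Suc L) (Suc M) p = eval3 (quot_series p)"
proof -
  have "coeff3 (local_series p) = (\<lambda>(a, b, c).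
     real (divisor_fun K (p ^ a)) * real (divisor_fun L (p ^ b)) *
        real (divisor_fun M (p ^ c)) *
        (g h (p ^ a) (p ^ b) (p ^ c) / real (lcm3 (p ^ a) (p ^ b) (p ^ c))))"
    using prime_gt_0_nat[OF assms]
    by (auto simp: fun_eq_iff coeff3_local_series coeff3_div_series[OF assms] corr_def prime_pow3_def)
  thus ?thesis unfolding local_factor_dvd_def eval3_quot_series[OF assms]
    unfolding eval3_def by simp
qed

lemma coeff3_var:
  "coeff3 (var1 s) (a, b, c) = (if b = 0 \<and> c = 0 then fps_nth s a else 0)"
  "coeff3 (var2 s) (a, b, c) = (if a = 0 \<and> c = 0 then fps_nth s b else 0)"
  "coeff3 (var3 s) (a, b, c) = (if a = 0 \<and> b = 0 then fps_nth s c else 0)"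
  using coeff3_var_mult[of s 1 1 a b c] coeff3_var_mult[of 1 s 1 a b c]
    coeff3_var_mult[of 1 1 s a b c] by auto

text \<open>For such p every gcd of powers of p has to be 1, so the support of the local series is
  the union of the three axes. The sum of the three axis series counts the origin three times, hence
  the two extra units on the left, which become the -2 in \<open>local_factor_ndvd\<close>.\<close>

lemma local_series_coprime:
  assumes "prime p" "\<not> p dvd 2 * h"
  shows "local_series p + 1 + 1 = var1 (geo (1 / real p) ^ K) + var2 (geo (1 / real p) ^ L) +
    var3 (geo (1 / real p) ^ M)"
proof (rule coeff3_eqI)
  fix e :: "nat \<times> nat \<times> nat"
  obtain a b c where e: "e = (a, b, c)" by (cases e)
  have p: "p > 0" "\<not> p dvd h" using assms prime_gt_0_nat by auto
  have dvd: "p ^ min i j dvd n \<longleftrightarrow> min i j = 0" if "\<not> p dvd n" for i j n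
    using that by (cases "min i j") (auto dest: dvd_mult_left)
  have geo0: "fps_nth (geo (1 / real p) ^ n) 0 = 1" for n
    by (simp add: fps_nth_power_0 geo_def)
  have D: "coeff3 (div_series p) (a, b, c) = fps_nth (geo (1 / real p) ^ K) a *
    fps_nth (geo (1 / real p) ^ L) b * fps_nth (geo (1 / real p) ^ M) c"
    by (simp add: div_series_def pow3_def coeff3_var_mult)
  have corr: "corr h (prime_pow3 p (a, b, c)) =
    (if (a = 0 \<and> b = 0) \<or> (a = 0 \<and> c = 0) \<or> (b = 0 \<and> c = 0) then 1 else 0)"
    using p by (auto simp: corr_def prime_pow3_def g_eq gcd_prime_powers dvd[OF assms(2)] dvd[OF p(2)])
  show "coeff3 (local_series p + 1 + 1) e = coeff3 (var1 (geo (1 / real p) ^ K) + var2 (geo (1 / real p) ^ L) +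
    var3 (geo (1 / real p) ^ M)) e"
    unfolding e coeff3_local_series coeff3_add coeff3_diff coeff3_1 coeff3_var D corr
    by (auto simp: geo0 zero_prod_def)
qed

lemma local_factor_ndvd_eq:
  assumes "prime p" "\<not> p dvd 2 * h"
  shows "local_factor_ndvd (Suc K) (Suc L) (Suc M) p = eval3 (quot_series p)"
proof -
  have p: "p \<ge> 2" using assms(1) by (rule prime_ge_2_nat)
  let ?c = "1 / real p"
  have r: "radius p \<ge> 1" "radius p \<ge> 0" using radius_ge_1[OF assms(1)] by auto
  have "((\<lambda>n. \<bar>fps_nth (geo ?c) n\<bar> * radius p ^ n) has_sum 4) UNIV"
    using has_sum_geo[of ?c "radius p"] p by (simp add: radius_def)
  note v = norm3_var[OF this]
  have g: "((\<lambda>n. fps_nth (geo ?c) n) has_sum (1 / (1 - ?c))) UNIV"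
    using p by (intro has_sum_geo') auto
  note ev = eval3_var[OF g]
  note pw = abs3_norm3_power[OF v(1) r(2), of K] abs3_norm3_power[OF v(3) r(2), of L]
    abs3_norm3_power[OF v(5) r(2), of M]
  have 1: "(coeff3 1 has_sum 1) UNIV"
    using abs3_eval[OF abs3_1 order_refl] by (simp add: eval3_1)
  have "((\<lambda>e. coeff3 (local_series p + 1 + 1) e) has_sum (1 / (1 - ?c)) ^ K + (1 / (1 - ?c)) ^ L + (1 / (1 - ?c)) ^ M) UNIV"
    unfolding local_series_coprime[OF assms] var_power coeff3_add
    using abs3_eval[OF conjunct1[OF pw(1)] r(1)] abs3_eval[OF conjunct1[OF pw(2)] r(1)]
      abs3_eval[OF conjunct1[OF pw(3)] r(1)]
    unfolding eval3_power[OF v(1) r(1)] eval3_power[OF v(3) r(1)] eval3_power[OF v(5) r(1)] ev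
    by (intro has_sum_add)
  moreover have "((\<lambda>e. coeff3 (local_series p + 1 + 1) e) has_sum eval3 (local_series p) + 1 + 1) UNIV"
    unfolding coeff3_add
    by (intro has_sum_add 1 abs3_eval[OF _ r(1)] local_series_norm assms)
  ultimately have "eval3 (local_series p) + 1 + 1 = (1 / (1 - ?c)) ^ K + (1 / (1 - ?c)) ^ L + (1 / (1 - ?c)) ^ M"
    by (rule has_sum_unique[symmetric])
  hence "eval3 (local_series p) = (1 / (1 - ?c)) ^ K + (1 / (1 - ?c)) ^ L + (1 / (1 - ?c)) ^ M - 2"
    by simp
  thus ?thesis
    by (simp add: local_factor_ndvd_def eval3_quot_series[OF assms(1)] power_int_minus power_one_over
      divide_inverse power_inverse)
qed

end

section \<open>The Euler product\<close>

lemma size3_mult3: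
  assumes "prime p" "t \<in> pos3"
  shows "multiplicity p (prod3 t) = size3 (mult3 p t)"
  using assms by (auto simp: pos3_def prod3_def mult3_def size3_def prime_elem_multiplicity_mult_distrib)

definition weight :: "nat \<times> nat \<times> nat \<Rightarrow> real" where
  "weight t = real (prod3 t) powr (1/4)"

lemma weight_multiplicative:
  assumes "finite P" "\<And>p. p \<in> P \<Longrightarrow> prime p" "prime_factors (prod3 t) \<subseteq> P" "t \<in> pos3"
  shows "weight t = (\<Prod>p\<in>P. (real p powr (1/4)) ^ size3 (mult3 p t))"
proof -
  have "prod3 t = (\<Prod>p\<in>P. p ^ multiplicity p (prod3 t))"
    using assms by (subst prod_multiplicity) (auto simp: pos3_prod3)
  also have "\<dots> = (\<Prod>p\<in>P. p ^ size3 (mult3 p t))"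
    using assms by (intro prod.cong refl) (simp add: size3_mult3)
  finally have "real (prod3 t) = (\<Prod>p\<in>P. real p ^ size3 (mult3 p t))"
    by (metis (no_types, lifting) of_nat_power of_nat_prod prod.cong)
  hence "weight t = (\<Prod>p\<in>P. (real p ^ size3 (mult3 p t)) powr (1/4))"
    by (simp add: weight_def prod_powr_distrib)
  also have "\<dots> = (\<Prod>p\<in>P. (real p powr (1/4)) ^ size3 (mult3 p t))"
    using assms(2) prime_gt_0_nat
    by (intro prod.cong refl) (simp add: powr_powr mult.commute flip: powr_realpow)
  finally show ?thesis .
qed

lemma weight_ge_1: "t \<in> pos3 \<Longrightarrow> weight t \<ge> 1"
  by (auto simp: weight_def pos3_prod3 intro!: ge_one_powr_ge_zero)

context lcm_sum
begin

definition quot_fun :: "nat \<times> nat \<times> nat \<Rightarrow> real" where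
  "quot_fun t = (\<Prod>p\<in>prime_factors (prod3 t). coeff3 (quot_series p) (mult3 p t))"

text \<open>Additional primes contribute the constant coefficient 1, so many triples can be expanded
  over one common set of primes.\<close>

lemma quot_fun_multiplicative:
  assumes "finite P" "\<And>p. p \<in> P \<Longrightarrow> prime p" "prime_factors (prod3 t) \<subseteq> P" "t \<in> pos3"
  shows "quot_fun t = (\<Prod>p\<in>P. coeff3 (quot_series p) (mult3 p t))"
  unfolding quot_fun_def
proof (intro prod.mono_neutral_left assms(1,3) ballI)
  fix p assume p: "p \<in> P - prime_factors (prod3 t)"
  hence "prime p" using assms(2) by auto
  hence "mult3 p t = 0" "p > 0" using p prime_factors_prod3[OF assms(4)] prime_gt_0_nat by auto
  thus "coeff3 (quot_series p) (mult3 p t) = 1"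
    using coeff3_quot_series_small[of p 0] by simp
qed

lemma summable_powr_32: "summable (\<lambda>n. real n powr (-3/2))"
  by (subst summable_real_powr_iff) simp

text \<open>A finite set of triples is covered by a box, over which the sum factors into local sums.
  Each of these is at most 1 plus a multiple of p^(-3/2), and 1 + y \<le> exp y bounds the product
  by the exponential of a convergent series.\<close>

lemma quot_fun_weight_summable: "(\<lambda>t. \<bar>quot_fun t\<bar> * weight t) summable_on pos3"
proof (rule nonneg_bdd_above_summable_on)
  show "0 \<le> \<bar>quot_fun t\<bar> * weight t" for t by (simp add: weight_def)
  let ?w = "\<lambda>p e. \<bar>coeff3 (quot_series p) e\<bar> * (real p powr (1/4)) ^ size3 e"
  let ?C = "\<Sum>n. 2 * quot_bound * real n powr (-3/2)"
  have summable: "summable (\<lambda>n. 2 * quot_bound * real n powr (-3/2))"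
    by (intro summable_mult summable_powr_32)
  show "bdd_above (sum (\<lambda>t. \<bar>quot_fun t\<bar> * weight t) ` {F. F \<subseteq> pos3 \<and> finite F})"
  proof (rule bdd_aboveI2)
    fix F assume "F \<in> {F. F \<subseteq> pos3 \<and> finite F}"
    hence F: "F \<subseteq> pos3" "finite F" by auto
    define P where "P = (\<Union>t\<in>F. prime_factors (prod3 t))"
    \<comment> \<open>The zero triple is inserted so that the constant term 1 can be split off at
      each prime.\<close>
    define B where "B = (\<lambda>p. insert 0 (mult3 p ` F))"
    have P: "finite P" "\<And>p. p \<in> P \<Longrightarrow> prime p" using F by (auto simp: P_def)
    have B: "finite (B p)" for p using F by (simp add: B_def)
    have sub: "F \<subseteq> box3 P B" using F by (auto simp: box3_def P_def B_def)
    have "(\<Sum>t\<in>F. \<bar>quot_fun t\<bar> * weight t) \<le> (\<Sum>t\<in>box3 P B. \<bar>quot_fun t\<bar> * weight t)"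
      using P B by (intro sum_mono2 sub finite_box3) (auto simp: weight_def)
    also have "\<dots> = (\<Sum>t\<in>box3 P B. \<Prod>p\<in>P. ?w p (mult3 p t))"
    proof (intro sum.cong refl)
      fix t assume "t \<in> box3 P B"
      hence t: "prime_factors (prod3 t) \<subseteq> P" "t \<in> pos3" by (auto simp: box3_def)
      show "\<bar>quot_fun t\<bar> * weight t = (\<Prod>p\<in>P. ?w p (mult3 p t))"
        by (simp only: quot_fun_multiplicative[OF P t] weight_multiplicative[OF P t] abs_prod prod.distrib)
    qed
    also have "\<dots> = (\<Prod>p\<in>P. \<Sum>e\<in>B p. ?w p e)"
      by (rule sum_box3[OF P B, where f = ?w])
    also have "\<dots> \<le> (\<Prod>p\<in>P. exp (2 * quot_bound * real p powr (-3/2)))"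
    proof (intro prod_mono conjI)
      fix p assume "p \<in> P"
      hence p: "prime p" by (rule P)
      show "0 \<le> (\<Sum>e\<in>B p. ?w p e)" by (intro sum_nonneg) auto
      have "(\<Sum>e\<in>B p. ?w p e) = ?w p 0 + (\<Sum>e\<in>B p - {0}. ?w p e)"
        using B by (intro sum.remove) (auto simp: B_def)
      also have "?w p 0 = 1" using coeff3_quot_series_small[of p 0] prime_gt_0_nat[OF p] by simp
      also have "(\<Sum>e\<in>B p - {0}. ?w p e) \<le> 2 * quot_bound * real p powr (-3/2)"
        using B by (intro quot_series_weight p) auto
      also have "1 + 2 * quot_bound * real p powr (-3/2) \<le> exp (2 * quot_bound * real p powr (-3/2))"
        by (rule exp_ge_add_one_self)
      finally show "(\<Sum>e\<in>B p. ?w p e) \<le> exp (2 * quot_bound * real p powr (-3/2))" by simp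
    qed
    also have "\<dots> = exp (\<Sum>p\<in>P. 2 * quot_bound * real p powr (-3/2))"
      using P(1) by (simp add: exp_sum)
    also have "\<dots> \<le> exp ?C"
      using quot_bound_nonneg by (simp only: exp_le_cancel_iff) (intro sum_le_suminf summable P(1); simp)
    finally show "(\<Sum>t\<in>F. \<bar>quot_fun t\<bar> * weight t) \<le> exp ?C" .
  qed
qed

definition quot_total :: real where "quot_total = (\<Sum>\<^sub>\<infinity>t\<in>pos3. quot_fun t)"

lemma quot_fun_has_sum: "(quot_fun has_sum quot_total) pos3"
proof -
  have "(\<lambda>t. norm (quot_fun t)) summable_on pos3"
  proof (rule Infinite_Sum.abs_summable_on_comparison_test'[OF quot_fun_weight_summable])
    fix t assume "t \<in> pos3"
    thus "norm (quot_fun t) \<le> \<bar>quot_fun t\<bar> * weight t"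
      using weight_ge_1[of t] by (simp add: mult_le_cancel_left1)
  qed
  thus ?thesis unfolding quot_total_def by (rule has_sum_infsum[OF abs_summable_summable])
qed

text \<open>The cubes are cofinal among finite sets of exponent triples, so the unordered sum is an
  ordinary limit. The sum of all sizes in a finite set serves as the side of a cube containing
  it.\<close>

lemma quot_series_partial_sums:
  assumes "prime p"
  shows "(\<lambda>E. \<Sum>e\<in>{..(E, E, E)}. coeff3 (quot_series p) e) \<longlonglongrightarrow> eval3 (quot_series p)"
proof -
  have "filterlim (\<lambda>E. {..(E, E, E)} :: (nat \<times> nat \<times> nat) set) (finite_subsets_at_top UNIV) sequentially"
    unfolding filterlim_finite_subsets_at_top
  proof (intro allI impI)
    fix X :: "(nat \<times> nat \<times> nat) set" assume X: "finite X \<and> X \<subseteq> UNIV"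
    define E0 where "E0 = (\<Sum>e\<in>X. size3 e)"
    have "e \<le> (E, E, E)" if "e \<in> X" "E \<ge> E0" for e E
    proof -
      have "size3 e \<le> E0" unfolding E0_def using X that by (intro member_le_sum) auto
      thus ?thesis using that(2) by (cases e) simp
    qed
    hence "\<forall>E\<ge>E0. finite {..(E, E, E)} \<and> X \<subseteq> {..(E, E, E)} \<and> {..(E, E, E)} \<subseteq> UNIV"
      by auto
    thus "\<forall>\<^sub>F E in sequentially. finite {..(E, E, E)} \<and> X \<subseteq> {..(E, E, E)} \<and> {..(E, E, E)} \<subseteq> (UNIV :: (nat \<times> nat \<times> nat) set)"
      unfolding eventually_sequentially by blast
  qed
  moreover have "(sum (coeff3 (quot_series p)) \<longlongrightarrow> eval3 (quot_series p)) (finite_subsets_at_top UNIV)"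
    using quot_series_eval[OF assms] by (simp add: has_sum_def)
  ultimately show ?thesis by (rule filterlim_compose[rotated])
qed

text \<open>This is what makes the infinite product in \<open>nabla\<close> converge absolutely. It
  is proved for partial sums, where the weights, being at least 1, only increase the terms.\<close>

lemma eval3_quot_series_bound:
  assumes "prime p"
  shows "\<bar>eval3 (quot_series p) - 1\<bar> \<le> 2 * quot_bound * real p powr (-3/2)"
proof (rule LIMSEQ_le_const2)
  show "(\<lambda>E. \<bar>(\<Sum>e\<in>{..(E, E, E)}. coeff3 (quot_series p) e) - 1\<bar>) \<longlonglongrightarrow> \<bar>eval3 (quot_series p) - 1\<bar>"
    by (intro tendsto_rabs tendsto_diff tendsto_const quot_series_partial_sums assms)
  have p: "p \<ge> 2" using assms by (rule prime_ge_2_nat)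
  have "\<bar>(\<Sum>e\<in>{..(E, E, E)}. coeff3 (quot_series p) e) - 1\<bar> \<le> 2 * quot_bound * real p powr (-3/2)" for E
  proof -
    have "(\<Sum>e\<in>{..(E, E, E)}. coeff3 (quot_series p) e) =
      coeff3 (quot_series p) 0 + (\<Sum>e\<in>{..(E, E, E)} - {0}. coeff3 (quot_series p) e)"
      by (intro sum.remove) (auto simp: zero_prod_def)
    also have "coeff3 (quot_series p) 0 = 1" using coeff3_quot_series_small[of p 0] p by simp
    finally have "\<bar>(\<Sum>e\<in>{..(E, E, E)}. coeff3 (quot_series p) e) - 1\<bar> =
      \<bar>\<Sum>e\<in>{..(E, E, E)} - {0}. coeff3 (quot_series p) e\<bar>" by simp
    also have "\<dots> \<le> (\<Sum>e\<in>{..(E, E, E)} - {0}. \<bar>coeff3 (quot_series p) e\<bar> * (real p powr (1/4)) ^ size3 e)"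
    proof (rule order.trans[OF sum_abs sum_mono])
      fix e
      have "1 \<le> (real p powr (1/4)) ^ size3 e"
        using p by (intro one_le_power ge_one_powr_ge_zero) auto
      thus "\<bar>coeff3 (quot_series p) e\<bar> \<le> \<bar>coeff3 (quot_series p) e\<bar> * (real p powr (1/4)) ^ size3 e"
        by (simp add: mult_le_cancel_left1)
    qed
    also have "\<dots> \<le> 2 * quot_bound * real p powr (-3/2)"
      by (intro quot_series_weight assms) auto
    finally show ?thesis .
  qed
  thus "\<exists>N. \<forall>E\<ge>N. \<bar>(\<Sum>e\<in>{..(E, E, E)}. coeff3 (quot_series p) e) - 1\<bar> \<le> 2 * quot_bound * real p powr (-3/2)"
    by blast
qed

text \<open>A product over p \<le> N of local sums truncated at exponent E is the sum of
  \<open>quot_fun\<close> over a box. Absolute summability makes this close to the total once the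
  box contains a suitable finite set, uniformly in E; thus E can tend to infinity before N
  does.\<close>

lemma euler_product: "(\<lambda>N. \<Prod>p | prime p \<and> p \<le> N. eval3 (quot_series p)) \<longlonglongrightarrow> quot_total"
proof (rule LIMSEQ_I)
  fix r :: real assume "r > 0"
  \<comment> \<open>Only a weak inequality survives the limit in E, so the estimate is made with a
    smaller bound.\<close>
  define r' where "r' = r / 2"
  have r': "r' > 0" "r' < r" using \<open>r > 0\<close> by (simp_all add: r'_def)
  have "\<forall>\<^sub>F F in finite_subsets_at_top pos3. dist (sum quot_fun F) quot_total < r'"
    using quot_fun_has_sum unfolding has_sum_def by (rule tendstoD) (rule r'(1))
  then obtain X where "finite X \<and> X \<subseteq> pos3 \<and>
    (\<forall>F. finite F \<and> X \<subseteq> F \<and> F \<subseteq> pos3 \<longrightarrow> dist (sum quot_fun F) quot_total < r')"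
    unfolding eventually_finite_subsets_at_top by (elim exE)
  hence X: "finite X" "X \<subseteq> pos3"
    "\<And>F. finite F \<Longrightarrow> X \<subseteq> F \<Longrightarrow> F \<subseteq> pos3 \<Longrightarrow> dist (sum quot_fun F) quot_total < r'"
    by simp_all
  \<comment> \<open>One threshold for both N and E: a prime factor of \<open>prod3 t\<close> and an
    exponent in \<open>t\<close> are each at most \<open>prod3 t\<close>, the latter since m < 2^m
    \<le> p^m.\<close>
  define N0 where "N0 = (\<Sum>t\<in>X. prod3 t)"
  have N0: "prod3 t \<le> N0" if "t \<in> X" for t
    unfolding N0_def using that X by (intro member_le_sum) auto
  have "norm ((\<Prod>p | prime p \<and> p \<le> N. eval3 (quot_series p)) - quot_total) \<le> r'" if N: "N \<ge> N0" for N
  proof (rule LIMSEQ_le_const2)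
    let ?P = "{p. prime p \<and> p \<le> N}"
    let ?B = "\<lambda>E (p::nat). {..(E, E, E)} :: (nat \<times> nat \<times> nat) set"
    have P: "finite ?P" "\<And>p. p \<in> ?P \<Longrightarrow> prime p" by auto
    show "(\<lambda>E. norm ((\<Prod>p\<in>?P. \<Sum>e\<in>{..(E, E, E)}. coeff3 (quot_series p) e) - quot_total))
      \<longlonglongrightarrow> norm ((\<Prod>p\<in>?P. eval3 (quot_series p)) - quot_total)"
      by (intro tendsto_norm tendsto_diff tendsto_prod tendsto_const quot_series_partial_sums) auto
    have "norm ((\<Prod>p\<in>?P. \<Sum>e\<in>{..(E, E, E)}. coeff3 (quot_series p) e) - quot_total) \<le> r'" if E: "E \<ge> N0" for E
    proof -
      have "(\<Prod>p\<in>?P. \<Sum>e\<in>{..(E, E, E)}. coeff3 (quot_series p) e) =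
        (\<Sum>t\<in>box3 ?P (?B E). \<Prod>p\<in>?P. coeff3 (quot_series p) (mult3 p t))"
        by (rule sum_box3[symmetric]) auto
      also have "\<dots> = (\<Sum>t\<in>box3 ?P (?B E). quot_fun t)"
        by (intro sum.cong refl quot_fun_multiplicative[symmetric] P) (auto simp: box3_def)
      finally have eq: "(\<Prod>p\<in>?P. \<Sum>e\<in>{..(E, E, E)}. coeff3 (quot_series p) e) = sum quot_fun (box3 ?P (?B E))" .
      have "X \<subseteq> box3 ?P (?B E)"
      proof
        fix t assume t: "t \<in> X"
        hence t': "t \<in> pos3" "prod3 t > 0" using X(2) pos3_prod3[of t] by blast+
        have "prime_factors (prod3 t) \<subseteq> ?P"
        proof
          fix p assume "p \<in> prime_factors (prod3 t)"
          hence "prime p" "p \<le> prod3 t" using t'(2) by (auto intro: dvd_imp_le)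
          thus "p \<in> ?P" using N0[OF t] N by auto
        qed
        moreover have "mult3 p t \<le> (E, E, E)" if "prime p" for p
        proof -
          have "size3 (mult3 p t) = multiplicity p (prod3 t)"
            using that t' by (simp add: size3_mult3)
          also have "\<dots> < 2 ^ multiplicity p (prod3 t)" by simp
          also have "\<dots> \<le> p ^ multiplicity p (prod3 t)"
            using prime_ge_2_nat[OF that] by (intro power_mono) auto
          also have "\<dots> \<le> prod3 t" using t'(2) by (intro dvd_imp_le multiplicity_dvd)
          also have "\<dots> \<le> E" using N0[OF t] E by simp
          finally show ?thesis by (cases "mult3 p t") auto
        qed
        ultimately show "t \<in> box3 ?P (?B E)" using t' by (auto simp: box3_def)
      qed
      moreover have "finite (box3 ?P (?B E))" by (intro finite_box3 P) auto
      moreover have "box3 ?P (?B E) \<subseteq> pos3" by (auto simp: box3_def)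
      ultimately have "dist (sum quot_fun (box3 ?P (?B E))) quot_total < r'" by (intro X(3))
      thus ?thesis unfolding eq by (simp add: dist_norm)
    qed
    thus "\<exists>E0. \<forall>E\<ge>E0. norm ((\<Prod>p\<in>?P. \<Sum>e\<in>{..(E, E, E)}. coeff3 (quot_series p) e) - quot_total) \<le> r'"
      by blast
  qed
  thus "\<exists>N0. \<forall>N\<ge>N0. norm ((\<Prod>p | prime p \<and> p \<le> N. eval3 (quot_series p)) - quot_total) < r"
    using r'(2) by (intro exI[of _ N0]) (meson le_less_trans)
qed

text \<open>Once N reaches 2 h, all primes dividing 2 h are among the primes up to N, so the finite
  product and a partial product of the infinite one combine to a partial Euler product.\<close>

lemma quot_total_eq_nabla: "quot_total = nabla h (Suc K) (Suc L) (Suc M)"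
proof -
  define f where "f = (\<lambda>p. if prime p \<and> \<not> p dvd 2 * h
    then local_factor_ndvd (Suc K) (Suc L) (Suc M) p else 1)"
  have bound: "norm (f n - 1) \<le> 2 * quot_bound * real n powr (-3/2)" for n
    using eval3_quot_series_bound[of n] local_factor_ndvd_eq[of n] quot_bound_nonneg
    by (auto simp: f_def)
  have "summable (\<lambda>n. norm (f n - 1))"
    by (rule summable_comparison_test'[OF summable_mult[OF summable_powr_32]]) (use bound in auto)
  hence "convergent_prod f"
    by (intro abs_convergent_prod_imp_convergent_prod summable_imp_abs_convergent_prod)
  hence lim: "(\<lambda>N. \<Prod>p\<le>N. f p) \<longlonglongrightarrow> prodinf f" by (rule convergent_prod_LIMSEQ)
  let ?D = "{p. prime p \<and> p dvd 2 * h}"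
  have D_le: "p \<le> 2 * h" if "p \<in> ?D" for p using that h_pos by (auto intro: dvd_imp_le)
  have finD: "finite ?D" by (rule finite_subset[of _ "{..2 * h}"]) (use D_le in auto)
  have eq: "(\<Prod>p\<in>?D. local_factor_dvd h (Suc K) (Suc L) (Suc M) p) * (\<Prod>p\<le>N. f p) =
    (\<Prod>p | prime p \<and> p \<le> N. eval3 (quot_series p))" if N: "N \<ge> 2 * h" for N
  proof -
    let ?R = "{p. prime p \<and> p \<le> N \<and> \<not> p dvd 2 * h}"
    have "(\<Prod>p\<le>N. f p) = (\<Prod>p\<in>?R. f p)"
      by (intro prod.mono_neutral_right) (auto simp: f_def)
    also have "\<dots> = (\<Prod>p\<in>?R. eval3 (quot_series p))"
      by (intro prod.cong refl) (auto simp: f_def local_factor_ndvd_eq)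
    finally have 1: "(\<Prod>p\<le>N. f p) = (\<Prod>p\<in>?R. eval3 (quot_series p))" .
    have 2: "(\<Prod>p\<in>?D. local_factor_dvd h (Suc K) (Suc L) (Suc M) p) = (\<Prod>p\<in>?D. eval3 (quot_series p))"
      by (intro prod.cong refl) (auto simp: local_factor_dvd_eq)
    have "{p. prime p \<and> p \<le> N} = ?D \<union> ?R" using N by (auto dest: D_le[OF CollectI, OF conjI])
    moreover have "(\<Prod>p\<in>?D \<union> ?R. eval3 (quot_series p)) =
      (\<Prod>p\<in>?D. eval3 (quot_series p)) * (\<Prod>p\<in>?R. eval3 (quot_series p))"
      using finD by (intro prod.union_disjoint) auto
    ultimately show ?thesis by (simp add: 1 2)
  qed
  have "(\<lambda>N. (\<Prod>p\<in>?D. local_factor_dvd h (Suc K) (Suc L) (Suc M) p) * (\<Prod>p\<le>N. f p)) \<longlonglongrightarrow>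
    nabla h (Suc K) (Suc L) (Suc M)"
    unfolding nabla_def f_def[symmetric] by (intro tendsto_mult tendsto_const lim)
  hence "(\<lambda>N. \<Prod>p | prime p \<and> p \<le> N. eval3 (quot_series p)) \<longlonglongrightarrow> nabla h (Suc K) (Suc L) (Suc M)"
    by (rule Lim_transform_eventually) (rule eventually_mono[OF eventually_ge_at_top[of "2 * h"]], rule eq)
  with euler_product show ?thesis by (rule LIMSEQ_unique)
qed

section \<open>The summand as a convolution, and its summation\<close>

definition term_fun :: "nat \<times> nat \<times> nat \<Rightarrow> real" where
  "term_fun = (\<lambda>(u, v, w). g h u v w / real (lcm3 u v w) *
     real (divisor_fun K u) * real (divisor_fun L v) * real (divisor_fun M w))"

definition div_fun :: "nat \<times> nat \<times> nat \<Rightarrow> real" where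
  "div_fun = (\<lambda>(u, v, w). real (divisor_fun K u) / real u * (real (divisor_fun L v) / real v) *
     (real (divisor_fun M w) / real w))"

definition quot3 :: "nat \<times> nat \<times> nat \<Rightarrow> nat \<times> nat \<times> nat \<Rightarrow> nat \<times> nat \<times> nat" where
  "quot3 = (\<lambda>(u, v, w) (a, b, c). (u div a, v div b, w div c))"

lemma term_fun_eq: "t \<in> pos3 \<Longrightarrow> term_fun t = div_fun t * corr h t"
  by (auto simp: term_fun_def div_fun_def corr_def pos3_def)

lemma div_fun_multiplicative:
  assumes "finite P" "\<And>p. p \<in> P \<Longrightarrow> prime p" "prime_factors (prod3 t) \<subseteq> P" "t \<in> pos3"
  shows "div_fun t = (\<Prod>p\<in>P. coeff3 (div_series p) (mult3 p t))"
proof -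
  obtain u v w where t: "t = (u, v, w)" by (cases t)
  have pos: "u > 0" "v > 0" "w > 0" using assms(4) by (auto simp: pos3_def t)
  have P: "prime_factors u \<subseteq> P" "prime_factors v \<subseteq> P" "prime_factors w \<subseteq> P"
    using assms(3,4) by (auto simp: t prod3_def pos3_def prime_factors_dvd subset_iff)
  have m: "real (divisor_fun k n) / real n = (\<Prod>p\<in>P. fps_nth (geo (1 / real p) ^ k) (multiplicity p n))"
    if "prime_factors n \<subseteq> P" "n > 0" for k n
    using divisor_fun_multiplicative[OF assms(1) _ that] assms(2) by blast
  show ?thesis
    unfolding t div_fun_def prod.case m[OF P(1) pos(1)] m[OF P(2) pos(2)] m[OF P(3) pos(3)]
    by (simp add: div_series_def pow3_def coeff3_var_mult mult3_def prod.distrib)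
qed

lemma multiplicity_div:
  assumes "prime p" "d dvd n" "n > (0::nat)"
  shows "multiplicity p (n div d) = multiplicity p n - multiplicity p d"
proof -
  obtain k where k: "n = d * k" using assms(2) by auto
  hence "d > 0" "k > 0" using assms(3) by auto
  thus ?thesis using assms(1) by (simp add: k prime_elem_multiplicity_mult_distrib)
qed

text \<open>Expanded over the primes of \<open>t\<close>, both sides become products over p, and the
  identity reduces to comparing coefficients in
  \<open>quot_series p * div_series p = local_series p\<close>.\<close>

lemma term_fun_conv:
  assumes "t \<in> pos3"
  shows "term_fun t = (\<Sum>d\<in>divisors3 t. quot_fun d * div_fun (quot3 t d))"
proof -
  let ?P = "prime_factors (prod3 t)"
  have P: "finite ?P" "\<And>p. p \<in> ?P \<Longrightarrow> prime p" by auto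
  have "(\<Sum>d\<in>divisors3 t. quot_fun d * div_fun (quot3 t d)) =
    (\<Sum>d\<in>divisors3 t. \<Prod>p\<in>?P. coeff3 (quot_series p) (mult3 p d) * coeff3 (div_series p) (mult3 p t - mult3 p d))"
  proof (intro sum.cong refl)
    fix d assume d: "d \<in> divisors3 t"
    have d': "d \<in> pos3" "prime_factors (prod3 d) \<subseteq> ?P"
      using divisors3_pos3[OF assms d] prime_factors_divisors3[OF assms d] by auto
    have q: "quot3 t d \<in> divisors3 t"
      using d by (auto simp: quot3_def divisors3_def split: prod.splits)
    have q': "quot3 t d \<in> pos3" "prime_factors (prod3 (quot3 t d)) \<subseteq> ?P"
      using divisors3_pos3[OF assms q] prime_factors_divisors3[OF assms q] by auto
    have "mult3 p (quot3 t d) = mult3 p t - mult3 p d" if "prime p" for p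
      using d assms that by (auto simp: mult3_def quot3_def divisors3_def pos3_def multiplicity_div)
    hence "(\<Prod>p\<in>?P. coeff3 (div_series p) (mult3 p (quot3 t d))) =
        (\<Prod>p\<in>?P. coeff3 (div_series p) (mult3 p t - mult3 p d))"
      by (intro prod.cong refl arg_cong2[of _ _ _ _ coeff3]) (auto intro: P(2))
    moreover have "div_fun (quot3 t d) = (\<Prod>p\<in>?P. coeff3 (div_series p) (mult3 p (quot3 t d)))"
      by (rule div_fun_multiplicative[OF P(1) _ q'(2,1)]) (rule P(2))
    moreover have "quot_fun d = (\<Prod>p\<in>?P. coeff3 (quot_series p) (mult3 p d))"
      by (rule quot_fun_multiplicative[OF P(1) _ d'(2,1)]) (rule P(2))
    ultimately show "quot_fun d * div_fun (quot3 t d) = (\<Prod>p\<in>?P. coeff3 (quot_series p) (mult3 p d) *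
      coeff3 (div_series p) (mult3 p t - mult3 p d))"
      by (simp only: prod.distrib)
  qed
  also have "\<dots> = (\<Prod>p\<in>?P. \<Sum>e\<le>mult3 p t. coeff3 (quot_series p) e * coeff3 (div_series p) (mult3 p t - e))"
    by (rule sum_divisors3[where f = "\<lambda>p e. coeff3 (quot_series p) e * coeff3 (div_series p) (mult3 p t - e)"])
       (use assms in auto)
  also have "\<dots> = (\<Prod>p\<in>?P. coeff3 (local_series p) (mult3 p t))"
    by (simp only: coeff3_mult[symmetric] quot_series_mult)
  also have "\<dots> = div_fun t * corr h t"
    unfolding coeff3_local_series prod.distrib
    using corr_multiplicative[OF P order_refl assms h_pos] div_fun_multiplicative[OF P order_refl assms]
    by simp
  finally show ?thesis using term_fun_eq[OF assms] by simp
qed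

lemma sum_upto_conv:
  "(\<Sum>u\<in>upto_real x. \<Sum>d | d dvd u. f d * (real (divisor_fun k (u div d)) / real (u div d))) =
   (\<Sum>d\<in>upto_real x. f d * divisor_sum k (x / real d))"
  using sum_upto_divisors[of "\<lambda>d n. f d * (real (divisor_fun k n) / real n)" x]
  by (simp only: divisor_sum_def sum_distrib_left)

lemma sum_divisors3_eq:
  "(\<Sum>d\<in>divisors3 (u, v, w). f d) = (\<Sum>a | a dvd u. \<Sum>b | b dvd v. \<Sum>c | c dvd w. f (a, b, c))"
  unfolding divisors3_def prod.case by (simp only: sum.cartesian_product case_prod_unfold prod.collapse)

lemma sum_swap3:
  "(\<Sum>w\<in>W. \<Sum>a\<in>A. \<Sum>b\<in>B. f w a b) = (\<Sum>a\<in>A. \<Sum>b\<in>B. \<Sum>w\<in>W. f w a b)"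
  by (subst sum.swap) (intro sum.cong refl sum.swap)

text \<open>The cutoffs on the three variables are independent, so the one-variable interchange is
  applied to w, v and u in turn; \<open>?Q2\<close> and \<open>?Q1\<close> collect what has already
  been summed.\<close>

lemma sum_term_fun:
  "(\<Sum>u\<in>upto_real x. \<Sum>v\<in>upto_real x. \<Sum>w\<in>upto_real x. term_fun (u, v, w)) =
   (\<Sum>a\<in>upto_real x. \<Sum>b\<in>upto_real x. \<Sum>c\<in>upto_real x. quot_fun (a, b, c) *
      (divisor_sum K (x / real a) * divisor_sum L (x / real b) * divisor_sum M (x / real c)))"
proof -
  let ?e = "\<lambda>k n. real (divisor_fun k n) / real n"
  let ?Q2 = "\<lambda>a b. \<Sum>c\<in>upto_real x. quot_fun (a, b, c) * divisor_sum M (x / real c)"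
  let ?Q1 = "\<lambda>a. \<Sum>b\<in>upto_real x. ?Q2 a b * divisor_sum L (x / real b)"
  have "(\<Sum>u\<in>upto_real x. \<Sum>v\<in>upto_real x. \<Sum>w\<in>upto_real x. term_fun (u, v, w)) =
    (\<Sum>u\<in>upto_real x. \<Sum>v\<in>upto_real x. \<Sum>w\<in>upto_real x. \<Sum>a | a dvd u. \<Sum>b | b dvd v. \<Sum>c | c dvd w.
       quot_fun (a, b, c) * (?e K (u div a) * ?e L (v div b) * ?e M (w div c)))"
  proof (intro sum.cong refl)
    fix u v w assume "u \<in> upto_real x" "v \<in> upto_real x" "w \<in> upto_real x"
    hence "(u, v, w) \<in> pos3" by (auto simp: pos3_def upto_real_def)
    thus "term_fun (u, v, w) = (\<Sum>a | a dvd u. \<Sum>b | b dvd v. \<Sum>c | c dvd w.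
       quot_fun (a, b, c) * (?e K (u div a) * ?e L (v div b) * ?e M (w div c)))"
      by (simp only: term_fun_conv sum_divisors3_eq quot3_def div_fun_def prod.case)
  qed
  also have "\<dots> = (\<Sum>u\<in>upto_real x. \<Sum>v\<in>upto_real x. \<Sum>a | a dvd u. \<Sum>b | b dvd v.
      ?Q2 a b * (?e K (u div a) * ?e L (v div b)))"
  proof (rule sum.cong[OF refl], rule sum.cong[OF refl])
    fix u v
    have "(\<Sum>w\<in>upto_real x. \<Sum>a | a dvd u. \<Sum>b | b dvd v. \<Sum>c | c dvd w.
       quot_fun (a, b, c) * (?e K (u div a) * ?e L (v div b) * ?e M (w div c))) =
      (\<Sum>a | a dvd u. \<Sum>b | b dvd v. \<Sum>w\<in>upto_real x. \<Sum>c | c dvd w.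
       (quot_fun (a, b, c) * (?e K (u div a) * ?e L (v div b))) * ?e M (w div c))"
      by (subst sum_swap3) (simp only: mult.assoc)
    also have "\<dots> =
      (\<Sum>a | a dvd u. \<Sum>b | b dvd v. ?Q2 a b * (?e K (u div a) * ?e L (v div b)))"
      unfolding sum_upto_conv by (intro sum.cong refl) (simp only: sum_distrib_right sum_distrib_left mult_ac)
    finally show "(\<Sum>w\<in>upto_real x. \<Sum>a | a dvd u. \<Sum>b | b dvd v. \<Sum>c | c dvd w.
       quot_fun (a, b, c) * (?e K (u div a) * ?e L (v div b) * ?e M (w div c))) =
      (\<Sum>a | a dvd u. \<Sum>b | b dvd v. ?Q2 a b * (?e K (u div a) * ?e L (v div b)))"
      .
  qed
  also have "\<dots> = (\<Sum>u\<in>upto_real x. \<Sum>a | a dvd u. ?Q1 a * ?e K (u div a))"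
  proof (rule sum.cong[OF refl])
    fix u
    have "(\<Sum>v\<in>upto_real x. \<Sum>a | a dvd u. \<Sum>b | b dvd v. ?Q2 a b * (?e K (u div a) * ?e L (v div b))) =
      (\<Sum>a | a dvd u. \<Sum>v\<in>upto_real x. \<Sum>b | b dvd v. (?Q2 a b * ?e K (u div a)) * ?e L (v div b))"
      by (subst sum.swap) (simp only: mult.assoc)
    also have "\<dots> = (\<Sum>a | a dvd u. ?Q1 a * ?e K (u div a))"
      unfolding sum_upto_conv by (intro sum.cong refl) (simp only: sum_distrib_right sum_distrib_left mult_ac)
    finally show "(\<Sum>v\<in>upto_real x. \<Sum>a | a dvd u. \<Sum>b | b dvd v. ?Q2 a b * (?e K (u div a) * ?e L (v div b))) =
      (\<Sum>a | a dvd u. ?Q1 a * ?e K (u div a))" .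
  qed
  also have "\<dots> = (\<Sum>a\<in>upto_real x. ?Q1 a * divisor_sum K (x / real a))"
    by (rule sum_upto_conv)
  also have "\<dots> = (\<Sum>a\<in>upto_real x. \<Sum>b\<in>upto_real x. \<Sum>c\<in>upto_real x. quot_fun (a, b, c) *
      (divisor_sum K (x / real a) * divisor_sum L (x / real b) * divisor_sum M (x / real c)))"
    by (simp only: sum_distrib_right sum_distrib_left mult_ac)
  finally show ?thesis .
qed

end

section \<open>The asymptotic formula\<close>

text \<open>The factors are replaced one at a time. Here \<open>r\<close> is a common relative
  error, later 1 / (1 + ln x), and r \<le> 1 bounds the factors not yet replaced by multiples of
  their scales.\<close>

lemma triple_product_error:
  fixes d1 d2 d3 m1 m2 m3 y1 y2 y3 c1 c2 c3 r :: real
  assumes "\<bar>d1 - m1\<bar> \<le> c1 * y1 * r" "\<bar>d2 - m2\<bar> \<le> c2 * y2 * r" "\<bar>d3 - m3\<bar> \<le> c3 * y3 * r"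
    and "\<bar>m1\<bar> \<le> y1" "\<bar>m2\<bar> \<le> y2" "\<bar>m3\<bar> \<le> y3"
    and "c1 \<ge> 0" "c2 \<ge> 0" "c3 \<ge> 0" "0 \<le> r" "r \<le> 1"
  shows "\<bar>d1 * d2 * d3 - m1 * m2 * m3\<bar> \<le>
    (c1 * (1 + c2) * (1 + c3) + c2 * (1 + c3) + c3) * (y1 * y2 * y3 * r)"
proof -
  have y: "y1 \<ge> 0" "y2 \<ge> 0" "y3 \<ge> 0" using assms by linarith+
  have le: "c * y * r \<le> c * y" if "c \<ge> 0" "y \<ge> 0" for c y :: real
    using that assms(10,11) by (intro mult_left_le) auto
  have D2: "\<bar>d2\<bar> \<le> (1 + c2) * y2" using le[of c2 y2] assms y unfolding distrib_right by linarith
  have D3: "\<bar>d3\<bar> \<le> (1 + c3) * y3" using le[of c3 y3] assms y unfolding distrib_right by linarith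
  have "d1 * d2 * d3 - m1 * m2 * m3 = (d1 - m1) * d2 * d3 + m1 * (d2 - m2) * d3 + m1 * m2 * (d3 - m3)"
    by (simp add: algebra_simps)
  hence "\<bar>d1 * d2 * d3 - m1 * m2 * m3\<bar> \<le>
    \<bar>d1 - m1\<bar> * \<bar>d2\<bar> * \<bar>d3\<bar> + \<bar>m1\<bar> * \<bar>d2 - m2\<bar> * \<bar>d3\<bar> + \<bar>m1\<bar> * \<bar>m2\<bar> * \<bar>d3 - m3\<bar>"
    unfolding abs_mult[symmetric] by linarith
  also have "\<dots> \<le> (c1 * y1 * r) * ((1 + c2) * y2) * ((1 + c3) * y3) +
      y1 * (c2 * y2 * r) * ((1 + c3) * y3) + y1 * y2 * (c3 * y3 * r)"
    using assms D2 D3 y by (intro add_mono mult_mono) auto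
  finally show ?thesis by (simp add: algebra_simps)
qed

text \<open>Trades the logarithms from \<open>divisor_sum_shift\<close> for the power built into
  \<open>weight\<close>; three of these factors give the constant 125.\<close>

lemma one_plus_ln_le:
  fixes a :: real
  assumes "a \<ge> 1"
  shows "1 + ln a \<le> 5 * a powr (1/4)"
proof -
  have "ln a \<le> a powr (1/4) / (1/4)" using assms by (intro ln_powr_bound) auto
  moreover have "1 \<le> a powr (1/4)" using assms by (intro ge_one_powr_ge_zero) auto
  ultimately show ?thesis by simp
qed

text \<open>Both the sum and its main term are sums of \<open>quot_fun\<close> over
  \<open>pos3\<close>, against the product of divisor sums and against a constant. The shifts make
  all three divisor indices positive, so each divisor sum has an error one logarithm below its main
  term.\<close>

lemma main_estimate:
  assumes "h > 0"
  shows "\<exists>C. \<forall>x\<ge>1.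
    \<bar>(\<Sum>u\<in>upto_real x. \<Sum>v\<in>upto_real x. \<Sum>w\<in>upto_real x.
        lcm_sum.term_fun h (Suc i) (Suc j) (Suc l) (u, v, w))
      - nabla h (Suc (Suc i)) (Suc (Suc j)) (Suc (Suc l)) *
         (ln x ^ (i + j + l + 3) / (fact (Suc i) * fact (Suc j) * fact (Suc l)))\<bar>
    \<le> C * (1 + ln x) ^ (i + j + l + 2)"
proof -
  interpret lcm_sum h "Suc i" "Suc j" "Suc l" by unfold_locales (rule assms)
  obtain c1 where c1: "c1 \<ge> 0" "\<And>x a. x \<ge> 1 \<Longrightarrow> a \<ge> 1 \<Longrightarrow>
      \<bar>divisor_sum (Suc i) (x / a) - ln x ^ Suc i / fact (Suc i)\<bar> \<le> c1 * (1 + ln x) ^ i * (1 + ln a)"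
    using divisor_sum_shift[of i] by blast
  obtain c2 where c2: "c2 \<ge> 0" "\<And>x a. x \<ge> 1 \<Longrightarrow> a \<ge> 1 \<Longrightarrow>
      \<bar>divisor_sum (Suc j) (x / a) - ln x ^ Suc j / fact (Suc j)\<bar> \<le> c2 * (1 + ln x) ^ j * (1 + ln a)"
    using divisor_sum_shift[of j] by blast
  obtain c3 where c3: "c3 \<ge> 0" "\<And>x a. x \<ge> 1 \<Longrightarrow> a \<ge> 1 \<Longrightarrow>
      \<bar>divisor_sum (Suc l) (x / a) - ln x ^ Suc l / fact (Suc l)\<bar> \<le> c3 * (1 + ln x) ^ l * (1 + ln a)"
    using divisor_sum_shift[of l] by blast
  define c where "c = c1 * (1 + c2) * (1 + c3) + c2 * (1 + c3) + c3"
  have c: "c \<ge> 0" using c1 c2 c3 by (simp add: c_def)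
  define W where "W = (\<Sum>\<^sub>\<infinity>t\<in>pos3. \<bar>quot_fun t\<bar> * weight t)"
  have "\<bar>(\<Sum>u\<in>upto_real x. \<Sum>v\<in>upto_real x. \<Sum>w\<in>upto_real x. term_fun (u, v, w))
      - quot_total * (ln x ^ (i + j + l + 3) / (fact (Suc i) * fact (Suc j) * fact (Suc l)))\<bar>
    \<le> (c * 125 * W) * (1 + ln x) ^ (i + j + l + 2)" if x: "x \<ge> 1" for x
  proof -
    define X where "X = 1 + ln x"
    have X: "X \<ge> 1" using x by (simp add: X_def)
    define D where "D = (\<lambda>(a, b, c). divisor_sum (Suc i) (x / real a) * divisor_sum (Suc j) (x / real b) *
      divisor_sum (Suc l) (x / real c))"
    define m where "m = (\<lambda>n. ln x ^ Suc n / fact (Suc n))"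
    have m: "\<bar>m n\<bar> \<le> X ^ Suc n" for n
    proof -
      have "0 \<le> ln x ^ Suc n" using x by simp
      hence "\<bar>m n\<bar> = ln x ^ Suc n / fact (Suc n)"
        unfolding m_def by (simp only: abs_divide abs_of_nonneg abs_of_pos[OF fact_gt_zero])
      also have "\<dots> \<le> ln x ^ Suc n / 1"
        using x by (intro divide_left_mono fact_ge_1) auto
      also have "\<dots> \<le> X ^ Suc n" unfolding X_def using x by (simp del: power_Suc add: power_mono)
      finally show ?thesis .
    qed
    have err: "\<bar>D t - m i * m j * m l\<bar> \<le> c * 125 * X ^ (i + j + l + 2) * weight t" if "t \<in> pos3" for t
    proof -
      obtain a b d where t: "t = (a, b, d)" by (cases t)
      have pos: "real a \<ge> 1" "real b \<ge> 1" "real d \<ge> 1" using that by (auto simp: t pos3_def)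
      let ?s = "\<lambda>a. 1 + ln (real a)"
      let ?y = "\<lambda>n a. X ^ Suc n * ?s a"
      have s: "?s a \<ge> 1" "?s b \<ge> 1" "?s d \<ge> 1" using pos by auto
      \<comment> \<open>Reads an absolute error as the relative error 1 / X on the scale
        \<open>X ^ Suc n * s\<close>, as \<open>triple_product_error\<close> requires.\<close>
      have y: "c * X ^ n * s = c * (X ^ Suc n * s) * (1 / X)" for c s n using X by simp
      have m': "\<bar>m n\<bar> \<le> X ^ Suc n * s" if "s \<ge> 1" for n s
      proof -
        have "X ^ Suc n * 1 \<le> X ^ Suc n * s" using that X by (intro mult_left_mono) auto
        thus ?thesis using m[of n] by simp
      qed
      have "\<bar>divisor_sum (Suc i) (x / real a) * divisor_sum (Suc j) (x / real b) *
          divisor_sum (Suc l) (x / real d) - m i * m j * m l\<bar> \<le> c * (?y i a * ?y j b * ?y l d * (1 / X))"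
        unfolding c_def
      proof (rule triple_product_error)
        show "\<bar>divisor_sum (Suc i) (x / real a) - m i\<bar> \<le> c1 * ?y i a * (1 / X)"
          using c1(2)[OF x pos(1)] unfolding y[symmetric] m_def X_def[symmetric] .
        show "\<bar>divisor_sum (Suc j) (x / real b) - m j\<bar> \<le> c2 * ?y j b * (1 / X)"
          using c2(2)[OF x pos(2)] unfolding y[symmetric] m_def X_def[symmetric] .
        show "\<bar>divisor_sum (Suc l) (x / real d) - m l\<bar> \<le> c3 * ?y l d * (1 / X)"
          using c3(2)[OF x pos(3)] unfolding y[symmetric] m_def X_def[symmetric] .
      qed (use m' s c1(1) c2(1) c3(1) X in auto)
      also have "?y i a * ?y j b * ?y l d * (1 / X) = X ^ (i + j + l + 2) * (?s a * ?s b * ?s d)"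
        using X by (simp add: power_add power2_eq_square)
      also have "?s a * ?s b * ?s d \<le> (5 * real a powr (1/4)) * (5 * real b powr (1/4)) * (5 * real d powr (1/4))"
        using s by (intro mult_mono one_plus_ln_le pos mult_nonneg_nonneg) auto
      also have "\<dots> = 125 * weight t" by (simp add: weight_def t prod3_def powr_mult)
      finally have "\<bar>divisor_sum (Suc i) (x / real a) * divisor_sum (Suc j) (x / real b) *
          divisor_sum (Suc l) (x / real d) - m i * m j * m l\<bar> \<le> c * (X ^ (i + j + l + 2) * (125 * weight t))"
        using c X by (simp add: mult_left_mono)
      thus ?thesis by (simp add: D_def t mult_ac)
    qed
    \<comment> \<open>If a coordinate of \<open>t\<close> exceeds x, the corresponding divisor sum
      is empty and \<open>D t\<close> = 0; hence the finite sum extends to all of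
      \<open>pos3\<close>.\<close>
    have S: "((\<lambda>t. quot_fun t * D t) has_sum
      (\<Sum>u\<in>upto_real x. \<Sum>v\<in>upto_real x. \<Sum>w\<in>upto_real x. term_fun (u, v, w))) pos3"
    proof -
      let ?U = "upto_real x \<times> upto_real x \<times> upto_real x"
      have "(\<Sum>u\<in>upto_real x. \<Sum>v\<in>upto_real x. \<Sum>w\<in>upto_real x. term_fun (u, v, w)) =
        (\<Sum>t\<in>?U. quot_fun t * D t)"
        unfolding sum_term_fun D_def by (simp add: sum.cartesian_product case_prod_unfold)
      moreover have "((\<lambda>t. quot_fun t * D t) has_sum (\<Sum>t\<in>?U. quot_fun t * D t)) ?U"
        by (intro has_sum_finite) auto
      moreover have zero: "D t = 0" if "t \<in> pos3 - ?U" for t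
      proof -
        have 0: "divisor_sum k (x / real a) = 0" if "a > 0" "a \<notin> upto_real x" for k a
          using that by (subst divisor_sum_def, subst upto_real_empty) (auto simp: upto_real_def)
        obtain a b d where t: "t = (a, b, d)" by (cases t)
        have "a > 0" "b > 0" "d > 0" "a \<notin> upto_real x \<or> b \<notin> upto_real x \<or> d \<notin> upto_real x"
          using that by (auto simp: pos3_def t)
        thus ?thesis using 0 by (auto simp: D_def t)
      qed
      moreover have sub: "?U \<subseteq> pos3" by (auto simp: pos3_def upto_real_def)
      have "((\<lambda>t. quot_fun t * D t) has_sum S) pos3 \<longleftrightarrow> ((\<lambda>t. quot_fun t * D t) has_sum S) ?U" for S
      proof (rule has_sum_cong_neutral)
        show "quot_fun t * D t = 0" if "t \<in> ?U - pos3" for t using that sub by blast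
        show "quot_fun t * D t = 0" if "t \<in> pos3 - ?U" for t using zero[OF that] by simp
      qed simp
      ultimately show ?thesis by simp
    qed
    have "((\<lambda>t. quot_fun t * D t + quot_fun t * (- (m i * m j * m l))) has_sum
      (\<Sum>u\<in>upto_real x. \<Sum>v\<in>upto_real x. \<Sum>w\<in>upto_real x. term_fun (u, v, w)) +
      quot_total * (- (m i * m j * m l))) pos3"
      by (intro has_sum_add S has_sum_cmult_left quot_fun_has_sum)
    moreover have "((\<lambda>t. c * 125 * X ^ (i + j + l + 2) * (\<bar>quot_fun t\<bar> * weight t)) has_sum
      (c * 125 * X ^ (i + j + l + 2) * W)) pos3"
      unfolding W_def by (intro has_sum_cmult_right has_sum_infsum quot_fun_weight_summable)
    moreover have "norm (quot_fun t * D t + quot_fun t * (- (m i * m j * m l))) \<le>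
      c * 125 * X ^ (i + j + l + 2) * (\<bar>quot_fun t\<bar> * weight t)" if "t \<in> pos3" for t
    proof -
      have "quot_fun t * D t + quot_fun t * (- (m i * m j * m l)) = quot_fun t * (D t - m i * m j * m l)"
        by (simp add: algebra_simps)
      hence "norm (quot_fun t * D t + quot_fun t * (- (m i * m j * m l))) =
        \<bar>quot_fun t\<bar> * \<bar>D t - m i * m j * m l\<bar>" by (simp add: abs_mult)
      also have "\<dots> \<le> \<bar>quot_fun t\<bar> * (c * 125 * X ^ (i + j + l + 2) * weight t)"
        by (intro mult_left_mono err that) auto
      finally show ?thesis by (simp add: mult_ac)
    qed
    ultimately have est: "norm ((\<Sum>u\<in>upto_real x. \<Sum>v\<in>upto_real x. \<Sum>w\<in>upto_real x. term_fun (u, v, w)) +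
      quot_total * (- (m i * m j * m l))) \<le> c * 125 * X ^ (i + j + l + 2) * W"
      by (rule norm_infsum_le)
    have eq: "m i * m j * m l = ln x ^ (i + j + l + 3) / (fact (Suc i) * fact (Suc j) * fact (Suc l))"
      by (simp add: m_def power_add power3_eq_cube del: fact_Suc)
    show ?thesis using est unfolding eq[symmetric] X_def[symmetric]
      by (simp only: real_norm_def mult_minus_right add_uminus_conv_diff mult_ac)
  qed
  thus ?thesis unfolding quot_total_eq_nabla by blast
qed

theorem theorem3p1:
  fixes h k l m :: nat
  assumes "h > 0" and "k \<ge> 2" and "l \<ge> 2" and "m \<ge> 2"
  shows "(\<lambda>x::real.
            (\<Sum>u | 0 < u \<and> real u \<le> x. \<Sum>v | 0 < v \<and> real v \<le> x. \<Sum>w | 0 < w \<and> real w \<le> x.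
               g h u v w / real (lcm3 u v w) *
               real (divisor_fun (k - 1) u) * real (divisor_fun (l - 1) v) *
               real (divisor_fun (m - 1) w))
            - nabla h k l m * (ln x ^ (k + l + m - 3) /
                (fact (k - 1) * fact (l - 1) * fact (m - 1))))
         \<in> O[at_top](\<lambda>x. ln x ^ (k + l + m - 4))"
proof -
  obtain i j n where klm: "k = Suc (Suc i)" "l = Suc (Suc j)" "m = Suc (Suc n)"
    using assms(2-4) by (metis add_2_eq_Suc le_Suc_ex)
  interpret lcm_sum h "Suc i" "Suc j" "Suc n" by unfold_locales (rule assms(1))
  obtain C where C: "\<And>x. x \<ge> 1 \<Longrightarrow>
    \<bar>(\<Sum>u\<in>upto_real x. \<Sum>v\<in>upto_real x. \<Sum>w\<in>upto_real x. term_fun (u, v, w))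
      - nabla h k l m * (ln x ^ (i + j + n + 3) / (fact (Suc i) * fact (Suc j) * fact (Suc n)))\<bar>
    \<le> C * (1 + ln x) ^ (i + j + n + 2)"
    unfolding klm using main_estimate[OF assms(1), of i j n] by blast
  have exps: "k + l + m - 3 = i + j + n + 3" "k + l + m - 4 = i + j + n + 2" by (simp_all add: klm)
  show ?thesis
  proof (rule bigoI[where c = "\<bar>C\<bar> * 2 ^ (i + j + n + 2)"], rule eventually_mono[OF eventually_ge_at_top])
    \<comment> \<open>From here on ln x \<ge> 1, so 1 + ln x \<le> 2 ln x; this is the source of the
      power of 2 in the constant.\<close>
    fix x :: real assume x: "x \<ge> exp 1"
    have "(1::real) \<le> exp 1" by simp
    hence x1: "x \<ge> 1" using x by linarith
    have "ln (exp 1) \<le> ln x" using x by (subst ln_le_cancel_iff) (auto intro: less_le_trans[OF exp_gt_zero])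
    hence lnx: "ln x \<ge> 1" by simp
    let ?S = "\<Sum>u | 0 < u \<and> real u \<le> x. \<Sum>v | 0 < v \<and> real v \<le> x. \<Sum>w | 0 < w \<and> real w \<le> x.
               g h u v w / real (lcm3 u v w) *
               real (divisor_fun (k - 1) u) * real (divisor_fun (l - 1) v) *
               real (divisor_fun (m - 1) w)"
    have "?S = (\<Sum>u\<in>upto_real x. \<Sum>v\<in>upto_real x. \<Sum>w\<in>upto_real x. term_fun (u, v, w))"
      by (simp add: upto_real_def term_fun_def klm)
    hence "\<bar>?S - nabla h k l m * (ln x ^ (k + l + m - 3) / (fact (k - 1) * fact (l - 1) * fact (m - 1)))\<bar>
      \<le> C * (1 + ln x) ^ (i + j + n + 2)"
      using C[OF x1] unfolding exps by (simp only: klm diff_Suc_1)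
    also have "\<dots> \<le> \<bar>C\<bar> * (2 * ln x) ^ (i + j + n + 2)"
      using lnx by (intro mult_mono power_mono) auto
    also have "\<dots> = \<bar>C\<bar> * 2 ^ (i + j + n + 2) * norm (ln x ^ (k + l + m - 4))"
      using lnx unfolding exps by (simp add: power_mult_distrib)
    finally show "norm (?S - nabla h k l m * (ln x ^ (k + l + m - 3) / (fact (k - 1) * fact (l - 1) * fact (m - 1))))
      \<le> \<bar>C\<bar> * 2 ^ (i + j + n + 2) * norm (ln x ^ (k + l + m - 4))"
      by (simp only: real_norm_def)
  qed
qed

end
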